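(* Let $\Gamma\Rightarrow\Delta$ be a sequent. If its structural Skolemization $(\Gamma\Rightarrow\Delta)^S$ is derivable in $\mathbf{LJ}^{++}$ by a cut-free proof using only atomic axioms, then $\Gamma\Rightarrow\Delta$ is cut-free $\mathbf{LJ}^{++}$-derivable.
   Context: Sequents are $\Gamma\Rightarrow\Delta$ with finite multisets of first-order formulas. $\mathbf{LK}$ is the usual first-order sequent calculus (axioms $p\Rightarrow p$, $p$ atomic, and $\bot\Rightarrow$; weakening, contraction, standard propositional rules, quantifier rules $(\forall L),(\exists R)$ with terms, $(\forall R),(\exists L)$ with eigenvariable condition, cut); $\mathbf{LJ}$ is its single-conclusion version. Rules $(\forall R),(\exists L)$ are strong-quantifier inferences and their eigen-variable $a$ is the characteristic variable. In a proof $\pi$, $a<_\pi b$ if $\pi$ contains a strong-quantifier inference from $\Gamma\Rightarrow A(a,b,\vec c)$ to $\Gamma\Rightarrow\forall xA(x,b,\vec c)$ or from $A(a,b,\vec c),\Gamma\Rightarrow\Delta$ to $\exists xA(x,b,\vec c),\Gamma\Rightarrow\Delta$. A quantifier inference is suitable for $\pi$ if it is a weak-quantifier inference, or its characteristic variable does not occur in the end-sequent of $\pi$, $<_\pi$ is acyclic, and any two strong-quantifier inferences with the same characteristic variable have the same principal formula. $\mathbf{LJ}^{++}$ is $\mathbf{LJ}$ without the eigenvariable condition, restricted to proofs all of whose quantifier inferences are suitable. Strong quantifiers: positive $\forall$ or negative $\exists$ (positive = in the antecedent of an even number of implications); structural Skolemization $F^S$ of a closed formula replaces successively the first strong quantifier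 $(Qy)$ by deleting it and substituting $f(x_1,\dots,x_n)$ for $y$, where $x_1,\dots,x_n$ are the variables of the weak quantifiers dominating it and $f$ is fresh. For a sequent, with $F=\bigwedge\Gamma\to\bigvee\Delta$ and $F^S=\bigwedge\Pi\to\bigvee\Lambda$, $(\Gamma\Rightarrow\Delta)^S:=\Pi\Rightarrow\Lambda$. *)

theory Defs
  imports "HOL-Library.Multiset"
begin

text \<open>First-order syntax in locally nameless form: free variables (which serve as characteristic
  variables) are named, bound variables are de Bruijn indices. A function or predicate symbol
  is a name together with the number of arguments it is applied to.\<close>

datatype 'f tm = Free nat | Bound nat | Fun 'f "'f tm list"

datatype ('f, 'p) fm =
    Bot
  | Pre 'p "'f tm list"
  | And "('f, 'p) fm" "('f, 'p) fm"
  | Or "('f, 'p) fm" "('f, 'p) fm"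
  | Imp "('f, 'p) fm" "('f, 'p) fm"
  | All "('f, 'p) fm"
  | Ex "('f, 'p) fm"

fun is_atom :: "('f, 'p) fm \<Rightarrow> bool" where
  "is_atom (Pre _ _) = True"
| "is_atom _ = False"

text \<open>All indices are smaller than \<open>k\<close>, respectively point to a quantifier of the formula or to
  one of \<open>k\<close> quantifiers outside of it. For \<open>k = 0\<close> there is no dangling index.\<close>

primrec lc_tm :: "nat \<Rightarrow> 'f tm \<Rightarrow> bool" where
  "lc_tm k (Free a) \<longleftrightarrow> True"
| "lc_tm k (Bound i) \<longleftrightarrow> i < k"
| "lc_tm k (Fun f ts) \<longleftrightarrow> list_all (lc_tm k) ts"

primrec lc :: "nat \<Rightarrow> ('f, 'p) fm \<Rightarrow> bool" where
  "lc k Bot \<longleftrightarrow> True"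
| "lc k (Pre p ts) \<longleftrightarrow> list_all (lc_tm k) ts"
| "lc k (And A B) \<longleftrightarrow> lc k A \<and> lc k B"
| "lc k (Or A B) \<longleftrightarrow> lc k A \<and> lc k B"
| "lc k (Imp A B) \<longleftrightarrow> lc k A \<and> lc k B"
| "lc k (All A) \<longleftrightarrow> lc (Suc k) A"
| "lc k (Ex A) \<longleftrightarrow> lc (Suc k) A"

primrec fv_tm :: "'f tm \<Rightarrow> nat set" where
  "fv_tm (Free a) = {a}"
| "fv_tm (Bound i) = {}"
| "fv_tm (Fun f ts) = \<Union> (set (map fv_tm ts))"

primrec fv :: "('f, 'p) fm \<Rightarrow> nat set" where
  "fv Bot = {}"
| "fv (Pre p ts) = (\<Union>t\<in>set ts. fv_tm t)"
| "fv (And A B) = fv A \<union> fv B"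
| "fv (Or A B) = fv A \<union> fv B"
| "fv (Imp A B) = fv A \<union> fv B"
| "fv (All A) = fv A"
| "fv (Ex A) = fv A"

primrec funs_tm :: "'f tm \<Rightarrow> 'f set" where
  "funs_tm (Free a) = {}"
| "funs_tm (Bound i) = {}"
| "funs_tm (Fun f ts) = insert f (\<Union> (set (map funs_tm ts)))"

primrec funs :: "('f, 'p) fm \<Rightarrow> 'f set" where
  "funs Bot = {}"
| "funs (Pre p ts) = (\<Union>t\<in>set ts. funs_tm t)"
| "funs (And A B) = funs A \<union> funs B"
| "funs (Or A B) = funs A \<union> funs B"
| "funs (Imp A B) = funs A \<union> funs B"
| "funs (All A) = funs A"
| "funs (Ex A) = funs A"

definition closed_fm :: "('f, 'p) fm \<Rightarrow> bool" where
  "closed_fm A \<longleftrightarrow> lc 0 A \<and> fv A = {}"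

primrec shift_tm :: "nat \<Rightarrow> 'f tm \<Rightarrow> 'f tm" where
  "shift_tm k (Free a) = Free a"
| "shift_tm k (Bound i) = Bound (i + k)"
| "shift_tm k (Fun f ts) = Fun f (map (shift_tm k) ts)"

text \<open>\<open>inst 0 t A\<close> is \<open>A(t)\<close> if \<open>A\<close> is the body of a quantified formula: the index of the
  removed quantifier is replaced by \<open>t\<close>, indices pointing further out are decremented. The term
  may contain dangling indices (as Skolem terms below do); these are adjusted under
  quantifiers, so that nothing is captured.\<close>

primrec inst_tm :: "nat \<Rightarrow> 'f tm \<Rightarrow> 'f tm \<Rightarrow> 'f tm" where
  "inst_tm k t (Free a) = Free a"
| "inst_tm k t (Bound i) = (if i < k then Bound i else if i = k then shift_tm k t else Bound (i - 1))"
| "inst_tm k t (Fun f ts) = Fun f (map (inst_tm k t) ts)"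

primrec inst :: "nat \<Rightarrow> 'f tm \<Rightarrow> ('f, 'p) fm \<Rightarrow> ('f, 'p) fm" where
  "inst k t Bot = Bot"
| "inst k t (Pre p ts) = Pre p (map (inst_tm k t) ts)"
| "inst k t (And A B) = And (inst k t A) (inst k t B)"
| "inst k t (Or A B) = Or (inst k t A) (inst k t B)"
| "inst k t (Imp A B) = Imp (inst k t A) (inst k t B)"
| "inst k t (All A) = All (inst (Suc k) t A)"
| "inst k t (Ex A) = Ex (inst (Suc k) t A)"

datatype ('f, 'p) sequent =
  Sequent (antecedent: "('f, 'p) fm multiset") (succedent: "('f, 'p) fm multiset")
    (infix "\<turnstile>" 50)

fun fv_seq :: "('f, 'p) sequent \<Rightarrow> nat set" where
  "fv_seq (\<Gamma> \<turnstile> \<Delta>) = (\<Union>A\<in>set_mset (\<Gamma> + \<Delta>). fv A)"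

fun lc_seq :: "('f, 'p) sequent \<Rightarrow> bool" where
  "lc_seq (\<Gamma> \<turnstile> \<Delta>) \<longleftrightarrow> (\<forall>A\<in>set_mset (\<Gamma> + \<Delta>). lc 0 A)"

text \<open>Names of inferences. A quantifier inference also records the body of its principal formula
  and the term, respectively the characteristic variable.\<close>

datatype ('f, 'p) rule =
    AxAtom | AxBot
  | WeakL | WeakR | ContrL | ContrR
  | AndL1 | AndL2 | AndR | OrL | OrR1 | OrR2 | ImpL | ImpR
  | AllL "('f, 'p) fm" "'f tm" | AllR "('f, 'p) fm" nat
  | ExL "('f, 'p) fm" nat | ExR "('f, 'p) fm" "'f tm"
  | Cut

text \<open>The inferences of \<open>\<^bold>L\<^bold>K\<close> without the eigenvariable condition: name, premises, conclusion.
  Negation is \<open>A \<rightarrow> \<bottom>\<close>.\<close>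

inductive lk_inference ::
  "('f, 'p) rule \<Rightarrow> ('f, 'p) sequent list \<Rightarrow> ('f, 'p) sequent \<Rightarrow> bool" where
  "is_atom A \<Longrightarrow> lk_inference AxAtom [] ({#A#} \<turnstile> {#A#})"
| "lk_inference AxBot [] ({#Bot#} \<turnstile> {#})"
| "lk_inference WeakL [\<Gamma> \<turnstile> \<Delta>] (add_mset A \<Gamma> \<turnstile> \<Delta>)"
| "lk_inference WeakR [\<Gamma> \<turnstile> \<Delta>] (\<Gamma> \<turnstile> add_mset A \<Delta>)"
| "lk_inference ContrL [add_mset A (add_mset A \<Gamma>) \<turnstile> \<Delta>] (add_mset A \<Gamma> \<turnstile> \<Delta>)"
| "lk_inference ContrR [\<Gamma> \<turnstile> add_mset A (add_mset A \<Delta>)] (\<Gamma> \<turnstile> add_mset A \<Delta>)"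
| "lk_inference AndL1 [add_mset A \<Gamma> \<turnstile> \<Delta>] (add_mset (And A B) \<Gamma> \<turnstile> \<Delta>)"
| "lk_inference AndL2 [add_mset B \<Gamma> \<turnstile> \<Delta>] (add_mset (And A B) \<Gamma> \<turnstile> \<Delta>)"
| "lk_inference AndR [\<Gamma> \<turnstile> add_mset A \<Delta>, \<Gamma> \<turnstile> add_mset B \<Delta>] (\<Gamma> \<turnstile> add_mset (And A B) \<Delta>)"
| "lk_inference OrL [add_mset A \<Gamma> \<turnstile> \<Delta>, add_mset B \<Gamma> \<turnstile> \<Delta>] (add_mset (Or A B) \<Gamma> \<turnstile> \<Delta>)"
| "lk_inference OrR1 [\<Gamma> \<turnstile> add_mset A \<Delta>] (\<Gamma> \<turnstile> add_mset (Or A B) \<Delta>)"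
| "lk_inference OrR2 [\<Gamma> \<turnstile> add_mset B \<Delta>] (\<Gamma> \<turnstile> add_mset (Or A B) \<Delta>)"
| "lk_inference ImpL [\<Gamma> \<turnstile> add_mset A \<Delta>, add_mset B \<Pi> \<turnstile> \<Lambda>] (add_mset (Imp A B) (\<Gamma> + \<Pi>) \<turnstile> \<Delta> + \<Lambda>)"
| "lk_inference ImpR [add_mset A \<Gamma> \<turnstile> add_mset B \<Delta>] (\<Gamma> \<turnstile> add_mset (Imp A B) \<Delta>)"
| "lc_tm 0 t \<Longrightarrow>
    lk_inference (AllL A t) [add_mset (inst 0 t A) \<Gamma> \<turnstile> \<Delta>] (add_mset (All A) \<Gamma> \<turnstile> \<Delta>)"
| "lk_inference (AllR A a) [\<Gamma> \<turnstile> add_mset (inst 0 (Free a) A) \<Delta>] (\<Gamma> \<turnstile> add_mset (All A) \<Delta>)"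
| "lk_inference (ExL A a) [add_mset (inst 0 (Free a) A) \<Gamma> \<turnstile> \<Delta>] (add_mset (Ex A) \<Gamma> \<turnstile> \<Delta>)"
| "lc_tm 0 t \<Longrightarrow>
    lk_inference (ExR A t) [\<Gamma> \<turnstile> add_mset (inst 0 t A) \<Delta>] (\<Gamma> \<turnstile> add_mset (Ex A) \<Delta>)"
| "lk_inference Cut [\<Gamma> \<turnstile> add_mset A \<Delta>, add_mset A \<Pi> \<turnstile> \<Lambda>] (\<Gamma> + \<Pi> \<turnstile> \<Delta> + \<Lambda>)"

datatype ('f, 'p) ptree =
  Infer "('f, 'p) rule" "('f, 'p) ptree list" (end_sequent: "('f, 'p) sequent")

primrec rules :: "('f, 'p) ptree \<Rightarrow> ('f, 'p) rule set" where
  "rules (Infer r \<pi>s S) = insert r (\<Union> (set (map rules \<pi>s)))"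

primrec initial_sequents :: "('f, 'p) ptree \<Rightarrow> ('f, 'p) sequent set" where
  "initial_sequents (Infer r \<pi>s S) =
    (if \<pi>s = [] then {S} else \<Union> (set (map initial_sequents \<pi>s)))"

text \<open>Derivations of \<open>\<^bold>L\<^bold>J\<close> without the eigenvariable condition: derivations of \<open>\<^bold>L\<^bold>K\<close> in which every
  succedent contains at most one formula.\<close>

primrec lj_tree :: "('f, 'p) ptree \<Rightarrow> bool" where
  "lj_tree (Infer r \<pi>s S) \<longleftrightarrow>
    lk_inference r (map end_sequent \<pi>s) S \<and> lc_seq S \<and> size (succedent S) \<le> 1 \<and>
    list_all lj_tree \<pi>s"

fun weak_quantifier_rule :: "('f, 'p) rule \<Rightarrow> bool" where
  "weak_quantifier_rule (AllL _ _) = True"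
| "weak_quantifier_rule (ExR _ _) = True"
| "weak_quantifier_rule _ = False"

text \<open>Characteristic variable and principal formula.\<close>

fun strong_quantifier_rule :: "('f, 'p) rule \<Rightarrow> (nat \<times> ('f, 'p) fm) option" where
  "strong_quantifier_rule (AllR A a) = Some (a, All A)"
| "strong_quantifier_rule (ExL A a) = Some (a, Ex A)"
| "strong_quantifier_rule _ = None"

definition strong_inferences :: "('f, 'p) ptree \<Rightarrow> (nat \<times> ('f, 'p) fm) set" where
  "strong_inferences \<pi> = {(a, P). \<exists>r\<in>rules \<pi>. strong_quantifier_rule r = Some (a, P)}"

text \<open>The relation \<open><\<^sub>\<pi>\<close> on variables. If the principal formula still contains the characteristic
  variable \<open>a\<close>, then \<open>a <\<^sub>\<pi> a\<close>.\<close>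

definition var_less :: "('f, 'p) ptree \<Rightarrow> (nat \<times> nat) set" where
  "var_less \<pi> = {(a, b). \<exists>P. (a, P) \<in> strong_inferences \<pi> \<and> b \<in> fv P}"

definition suitable :: "('f, 'p) ptree \<Rightarrow> ('f, 'p) rule \<Rightarrow> bool" where
  "suitable \<pi> r \<longleftrightarrow>
    weak_quantifier_rule r \<or>
    (\<exists>a P. strong_quantifier_rule r = Some (a, P) \<and> a \<notin> fv_seq (end_sequent \<pi>)) \<and>
    acyclic (var_less \<pi>) \<and>
    (\<forall>b P Q. (b, P) \<in> strong_inferences \<pi> \<longrightarrow> (b, Q) \<in> strong_inferences \<pi> \<longrightarrow> P = Q)"

definition quantifier_rule :: "('f, 'p) rule \<Rightarrow> bool" where
  "quantifier_rule r \<longleftrightarrow> weak_quantifier_rule r \<or> strong_quantifier_rule r \<noteq> None"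

definition LJpp_proof :: "('f, 'p) ptree \<Rightarrow> bool" where
  "LJpp_proof \<pi> \<longleftrightarrow> lj_tree \<pi> \<and> (\<forall>r\<in>rules \<pi>. quantifier_rule r \<longrightarrow> suitable \<pi> r)"

definition cut_free :: "('f, 'p) ptree \<Rightarrow> bool" where
  "cut_free \<pi> \<longleftrightarrow> Cut \<notin> rules \<pi>"

definition atomic_axioms :: "('f, 'p) ptree \<Rightarrow> bool" where
  "atomic_axioms \<pi> \<longleftrightarrow>
    (\<forall>S\<in>initial_sequents \<pi>. (\<exists>A. is_atom A \<and> S = ({#A#} \<turnstile> {#A#})) \<or> S = ({#Bot#} \<turnstile> {#}))"

text \<open>\<open>has_strong p A\<close>: \<open>A\<close> contains a strong quantifier, when \<open>A\<close> itself occurs positively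
  (\<open>p = True\<close>) or negatively (\<open>p = False\<close>).\<close>

primrec has_strong :: "bool \<Rightarrow> ('f, 'p) fm \<Rightarrow> bool" where
  "has_strong p Bot \<longleftrightarrow> False"
| "has_strong p (Pre q ts) \<longleftrightarrow> False"
| "has_strong p (And A B) \<longleftrightarrow> has_strong p A \<or> has_strong p B"
| "has_strong p (Or A B) \<longleftrightarrow> has_strong p A \<or> has_strong p B"
| "has_strong p (Imp A B) \<longleftrightarrow> has_strong (\<not> p) A \<or> has_strong p B"
| "has_strong p (All A) \<longleftrightarrow> p \<or> has_strong p A"
| "has_strong p (Ex A) \<longleftrightarrow> \<not> p \<or> has_strong p A"

text \<open>Deletes the first (leftmost) strong quantifier and substitutes the Skolem term for its
  variable. The argument \<open>n\<close> counts the quantifiers passed so far; none of them is strong, since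
  otherwise the search would have stopped there. Hence they are exactly the weak quantifiers
  dominating the deleted one, and their variables, outermost first, are the indices
  \<open>n - 1, \<dots>, 0\<close>.\<close>

primrec skolem_first :: "bool \<Rightarrow> nat \<Rightarrow> 'f \<Rightarrow> ('f, 'p) fm \<Rightarrow> ('f, 'p) fm" where
  "skolem_first p n f Bot = Bot"
| "skolem_first p n f (Pre q ts) = Pre q ts"
| "skolem_first p n f (And A B) =
    (if has_strong p A then And (skolem_first p n f A) B else And A (skolem_first p n f B))"
| "skolem_first p n f (Or A B) =
    (if has_strong p A then Or (skolem_first p n f A) B else Or A (skolem_first p n f B))"
| "skolem_first p n f (Imp A B) =
    (if has_strong (\<not> p) A then Imp (skolem_first (\<not> p) n f A) B
     else Imp A (skolem_first p n f B))"
| "skolem_first p n f (All A) =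
    (if p then inst 0 (Fun f (map Bound (rev [0..<n]))) A else All (skolem_first p (Suc n) f A))"
| "skolem_first p n f (Ex A) =
    (if \<not> p then inst 0 (Fun f (map Bound (rev [0..<n]))) A else Ex (skolem_first p (Suc n) f A))"

text \<open>Iteration until no strong quantifier is left; \<open>U\<close> collects the function symbols that are no
  longer fresh.\<close>

inductive skolem_iter :: "'f set \<Rightarrow> ('f, 'p) fm \<Rightarrow> ('f, 'p) fm \<Rightarrow> bool" where
  "\<not> has_strong True F \<Longrightarrow> skolem_iter U F F"
| "has_strong True F \<Longrightarrow> f \<notin> U \<Longrightarrow> skolem_iter (insert f U) (skolem_first True 0 f F) G \<Longrightarrow>
    skolem_iter U F G"

text \<open>\<open>G\<close> is a structural Skolemization \<open>F\<^sup>S\<close> of the closed formula \<open>F\<close>. It is a relation because the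
  choice of the fresh symbols is free.\<close>

definition skolemization :: "('f, 'p) fm \<Rightarrow> ('f, 'p) fm \<Rightarrow> bool" where
  "skolemization F G \<longleftrightarrow> closed_fm F \<and> skolem_iter (funs F) F G"

fun Conj :: "('f, 'p) fm list \<Rightarrow> ('f, 'p) fm" where
  "Conj [] = Imp Bot Bot"
| "Conj [A] = A"
| "Conj (A # B # As) = And A (Conj (B # As))"

fun Disj :: "('f, 'p) fm list \<Rightarrow> ('f, 'p) fm" where
  "Disj [] = Bot"
| "Disj [A] = A"
| "Disj (A # B # As) = Or A (Disj (B # As))"

text \<open>The lists enumerate the multisets. The conditions on their lengths make the decomposition of
  \<open>F\<^sup>S\<close> into conjuncts and disjuncts the one inherited from \<open>F\<close>.\<close>

definition seq_skolemization :: "('f, 'p) sequent \<Rightarrow> ('f, 'p) sequent \<Rightarrow> bool" where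
  "seq_skolemization S T \<longleftrightarrow>
    (\<exists>As Bs Cs Ds. S = (mset As \<turnstile> mset Bs) \<and> T = (mset Cs \<turnstile> mset Ds) \<and>
      length Cs = length As \<and> length Ds = length Bs \<and>
      skolemization (Imp (Conj As) (Disj Bs)) (Imp (Conj Cs) (Disj Ds)))"

end

theory Submission
  imports Defs "HOL-Library.Nat_Bijection"
begin

text \<open>
  Skolem functions are eliminated one at a time, the last one introduced first. In a cut-free
  derivation whose end-sequent contains the Skolem function \<open>f\<close>, every term \<open>f(t\<^sub>1,\<dots>,t\<^sub>n)\<close> is
  replaced by a variable named after it, and below the inference where the instance
  \<open>A(f(t\<^sub>1,\<dots>,t\<^sub>n))\<close> appears the deleted strong quantifier is reintroduced with that variable as
  characteristic variable. Without the eigenvariable condition no inference has to be moved. The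
  variable determines the terms \<open>t\<^sub>i\<close> and hence the principal formula. It depends only on
  variables occurring in the translated \<open>t\<^sub>i\<close>: those standing for Skolem terms name smaller terms, and the
  old ones already occurred in the formulas containing \<open>f(t\<^sub>1,\<dots>,t\<^sub>n)\<close>, so no cycle arises.
\<close>

section \<open>Provability relative to a set of strong inferences\<close>

text \<open>Suitability of an inference refers to the whole tree, which blocks a direct induction.
  It is therefore detached from the tree: a suitable set \<open>\<Sigma>\<close> of pairs of
  variable and principal formula is fixed in advance, and derivability using only these pairs is a
  local notion. The set for the translated derivation is defined from \<open>\<Sigma>\<close> and
  the Skolemized subformula alone, so its suitability is proved before any inference is translated.

  The obstacle is a Skolem term whose arguments are still bound by weak quantifiers: it has no name
  yet. In a cut-free derivation such terms occur only in formulas descending from the end-sequent,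
  and these are remembered as the original subformula \<open>A\<close> together with the terms
  \<open>e\<close> already substituted for its weak quantifiers. A cut formula could contain
  \<open>f\<close> applied to bound variables without any such origin. Atomicity of axioms matters
  for a similar reason: the two occurrences of a compound formula have opposite polarity and may
  need different replacements, whereas two occurrences of an atom both reduce to its
  translation.\<close>

primrec inference_allowed ::
  "(nat \<times> ('f, 'p) fm) set \<Rightarrow> 'f set \<Rightarrow> ('f, 'p) rule \<Rightarrow> bool" where
  "inference_allowed \<Sigma> K AxAtom = True"
| "inference_allowed \<Sigma> K AxBot = True"
| "inference_allowed \<Sigma> K WeakL = True"
| "inference_allowed \<Sigma> K WeakR = True"
| "inference_allowed \<Sigma> K ContrL = True"
| "inference_allowed \<Sigma> K ContrR = True"
| "inference_allowed \<Sigma> K AndL1 = True"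
| "inference_allowed \<Sigma> K AndL2 = True"
| "inference_allowed \<Sigma> K AndR = True"
| "inference_allowed \<Sigma> K OrL = True"
| "inference_allowed \<Sigma> K OrR1 = True"
| "inference_allowed \<Sigma> K OrR2 = True"
| "inference_allowed \<Sigma> K ImpL = True"
| "inference_allowed \<Sigma> K ImpR = True"
| "inference_allowed \<Sigma> K (AllL A t) = (funs_tm t \<subseteq> K)"
| "inference_allowed \<Sigma> K (AllR A a) = ((a, All A) \<in> \<Sigma>)"
| "inference_allowed \<Sigma> K (ExL A a) = ((a, Ex A) \<in> \<Sigma>)"
| "inference_allowed \<Sigma> K (ExR A t) = (funs_tm t \<subseteq> K)"
| "inference_allowed \<Sigma> K Cut = False"

definition lj_sequent :: "('f, 'p) sequent \<Rightarrow> bool" where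
  "lj_sequent S \<longleftrightarrow> lc_seq S \<and> size (succedent S) \<le> 1"

inductive derivable_within ::
  "(nat \<times> ('f, 'p) fm) set \<Rightarrow> 'f set \<Rightarrow> ('f, 'p) sequent \<Rightarrow> bool" for \<Sigma> K where
  derivable_withinI: "lk_inference r Ss S \<Longrightarrow> inference_allowed \<Sigma> K r \<Longrightarrow> lj_sequent S \<Longrightarrow>
    (\<And>S'. S' \<in> set Ss \<Longrightarrow> derivable_within \<Sigma> K S') \<Longrightarrow> derivable_within \<Sigma> K S"

definition dependencies :: "(nat \<times> ('f, 'p) fm) set \<Rightarrow> (nat \<times> nat) set" where
  "dependencies \<Sigma> = {(a, b). \<exists>P. (a, P) \<in> \<Sigma> \<and> b \<in> fv P}"

definition suitable_set :: "(nat \<times> ('f, 'p) fm) set \<Rightarrow> bool" where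
  "suitable_set \<Sigma> \<longleftrightarrow> acyclic (dependencies \<Sigma>) \<and>
    (\<forall>a P Q. (a, P) \<in> \<Sigma> \<longrightarrow> (a, Q) \<in> \<Sigma> \<longrightarrow> P = Q)"

text \<open>The requirement that characteristic variables avoid the end-sequent is left out here; it
  is recovered at the very end from closedness. Finiteness of \<open>K\<close> is what allows terms
  over \<open>K\<close> to be numbered by variables.\<close>

definition suitably_derivable :: "('f, 'p) sequent \<Rightarrow> bool" where
  "suitably_derivable S \<longleftrightarrow> (\<exists>\<Sigma> K. finite K \<and> (\<forall>(a, P) \<in> \<Sigma>. funs P \<subseteq> K) \<and> suitable_set \<Sigma> \<and>
    derivable_within \<Sigma> K S)"

lemma derivable_within_mono:
  "derivable_within \<Sigma> K S \<Longrightarrow> \<Sigma> \<subseteq> \<Sigma>' \<Longrightarrow> K \<subseteq> K' \<Longrightarrow> derivable_within \<Sigma>' K' S"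
proof (induction rule: derivable_within.induct)
  case (derivable_withinI r Ss S)
  have "inference_allowed \<Sigma>' K' r"
    using derivable_withinI by (cases r) auto
  then show ?case
    using derivable_withinI by (blast intro: derivable_within.intros)
qed

section \<open>Passing between proof trees and relative derivability\<close>

primrec funs_rule :: "('f, 'p) rule \<Rightarrow> 'f set" where
  "funs_rule AxAtom = {}"
| "funs_rule AxBot = {}"
| "funs_rule WeakL = {}"
| "funs_rule WeakR = {}"
| "funs_rule ContrL = {}"
| "funs_rule ContrR = {}"
| "funs_rule AndL1 = {}"
| "funs_rule AndL2 = {}"
| "funs_rule AndR = {}"
| "funs_rule OrL = {}"
| "funs_rule OrR1 = {}"
| "funs_rule OrR2 = {}"
| "funs_rule ImpL = {}"
| "funs_rule ImpR = {}"
| "funs_rule (AllL A t) = funs_tm t"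
| "funs_rule (AllR A a) = funs A"
| "funs_rule (ExL A a) = funs A"
| "funs_rule (ExR A t) = funs_tm t"
| "funs_rule Cut = {}"

lemma finite_funs_tm [simp]: "finite (funs_tm t)"
  by (induction t) auto

lemma finite_funs [simp]: "finite (funs A)"
  by (induction A) auto

lemma finite_rules: "finite (rules \<pi>)"
  by (induction \<pi>) auto

lemma finite_funs_rule: "finite (funs_rule r)"
  by (cases r) auto

lemma derivable_within_of_tree:
  assumes "lj_tree \<pi>" and "\<And>r. r \<in> rules \<pi> \<Longrightarrow> inference_allowed \<Sigma> K r"
  shows "derivable_within \<Sigma> K (end_sequent \<pi>)"
  using assms
proof (induction \<pi>)
  case (Infer r \<pi>s S)
  show ?case
  proof (rule derivable_withinI)
    show "lk_inference r (map end_sequent \<pi>s) (end_sequent (Infer r \<pi>s S))"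
      using Infer.prems(1) by simp
    show "inference_allowed \<Sigma> K r" using Infer.prems(2) by simp
    show "lj_sequent (end_sequent (Infer r \<pi>s S))"
      using Infer.prems(1) by (simp add: lj_sequent_def)
    fix S' assume "S' \<in> set (map end_sequent \<pi>s)"
    then obtain \<rho> where \<rho>: "\<rho> \<in> set \<pi>s" "S' = end_sequent \<rho>" by auto
    have "lj_tree \<rho>" using Infer.prems(1) \<rho> by (auto simp: list_all_iff)
    moreover have "\<And>r. r \<in> rules \<rho> \<Longrightarrow> inference_allowed \<Sigma> K r"
      using Infer.prems(2) \<rho> by auto
    ultimately show "derivable_within \<Sigma> K S'" using Infer.IH \<rho> by blast
  qed
qed

lemma tree_of_derivable_within:
  assumes "derivable_within \<Sigma> K S"
  shows "\<exists>\<pi>. lj_tree \<pi> \<and> end_sequent \<pi> = S \<and> (\<forall>r\<in>rules \<pi>. inference_allowed \<Sigma> K r)"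
  using assms
proof (induction rule: derivable_within.induct)
  case (derivable_withinI r Ss S)
  then obtain p where p: "\<And>S'. S' \<in> set Ss \<Longrightarrow>
      lj_tree (p S') \<and> end_sequent (p S') = S' \<and> (\<forall>r\<in>rules (p S'). inference_allowed \<Sigma> K r)"
    by metis
  have "map end_sequent (map p Ss) = Ss"
    using p by (induction Ss) auto
  then have "lj_tree (Infer r (map p Ss) S)"
    using derivable_withinI p by (auto simp: lj_sequent_def list_all_iff comp_def)
  moreover have "\<forall>r\<in>rules (Infer r (map p Ss) S). inference_allowed \<Sigma> K r"
    using derivable_withinI p by auto
  ultimately show ?case by (intro exI[of _ "Infer r (map p Ss) S"]) simp
qed

lemma suitably_derivable_of_proof:
  assumes "LJpp_proof \<pi>" and "cut_free \<pi>"
  shows "suitably_derivable (end_sequent \<pi>)"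
proof -
  let ?\<Sigma> = "strong_inferences \<pi>"
  let ?K = "\<Union>(funs_rule ` rules \<pi>)"
  have "inference_allowed ?\<Sigma> ?K r" if "r \<in> rules \<pi>" for r
    using that assms(2)
    by (cases r) (force simp: strong_inferences_def cut_free_def)+
  then have "derivable_within ?\<Sigma> ?K (end_sequent \<pi>)"
    using assms(1) by (auto simp: LJpp_proof_def intro: derivable_within_of_tree)
  moreover have "finite ?K" by (simp add: finite_rules finite_funs_rule)
  moreover have "funs P \<subseteq> ?K" if aP: "(a, P) \<in> ?\<Sigma>" for a P
  proof -
    obtain r where r: "r \<in> rules \<pi>" "strong_quantifier_rule r = Some (a, P)"
      using aP by (auto simp: strong_inferences_def)
    have "funs P = funs_rule r" using r(2) by (cases r) auto
    then show ?thesis using r(1) by blast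
  qed
  moreover have "suitable_set ?\<Sigma>"
  \<comment> \<open>Acyclicity and uniqueness of principal formulas are asserted only as part of the
    suitability of a strong inference, so one such inference is needed to read them off; without
    any, the set is empty.\<close>
  proof (cases "?\<Sigma> = {}")
    case True
    then show ?thesis by (simp add: suitable_set_def dependencies_def acyclic_def)
  next
    case False
    then obtain r a P where r: "r \<in> rules \<pi>" "strong_quantifier_rule r = Some (a, P)"
      by (auto simp: strong_inferences_def)
    then have "suitable \<pi> r" "\<not> weak_quantifier_rule r"
      using assms(1) by (auto simp: LJpp_proof_def quantifier_rule_def) (cases r; simp)
    then show ?thesis
      by (auto simp: suitable_def suitable_set_def dependencies_def var_less_def)
  qed
  ultimately show ?thesis
    unfolding suitably_derivable_def by (intro exI[of _ ?\<Sigma>] exI[of _ ?K]) auto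
qed

text \<open>The tree may use only part of \<open>\<Sigma>\<close>, but both conditions of
  \<open>suitable_set\<close> pass to subsets.\<close>

lemma proof_of_suitably_derivable:
  assumes "suitably_derivable S" and "fv_seq S = {}"
  shows "\<exists>\<pi>. LJpp_proof \<pi> \<and> end_sequent \<pi> = S \<and> cut_free \<pi>"
proof -
  obtain \<Sigma> K where \<Sigma>: "suitable_set \<Sigma>" "derivable_within \<Sigma> K S"
    using assms(1) by (auto simp: suitably_derivable_def)
  obtain \<pi> where \<pi>: "lj_tree \<pi>" "end_sequent \<pi> = S"
      "\<forall>r\<in>rules \<pi>. inference_allowed \<Sigma> K r"
    using tree_of_derivable_within[OF \<Sigma>(2)] by blast
  have sub: "strong_inferences \<pi> \<subseteq> \<Sigma>"
  proof (rule subrelI)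
    fix a P assume "(a, P) \<in> strong_inferences \<pi>"
    then obtain r where "r \<in> rules \<pi>" "strong_quantifier_rule r = Some (a, P)"
      by (auto simp: strong_inferences_def)
    then show "(a, P) \<in> \<Sigma>" using \<pi>(3) by (cases r) auto
  qed
  then have "var_less \<pi> \<subseteq> dependencies \<Sigma>"
    by (auto simp: var_less_def dependencies_def)
  then have acyc: "acyclic (var_less \<pi>)"
    using \<Sigma>(1) acyclic_subset by (auto simp: suitable_set_def)
  have "P = Q" if "(a, P) \<in> strong_inferences \<pi>" "(a, Q) \<in> strong_inferences \<pi>" for a P Q
    using that sub \<Sigma>(1) unfolding suitable_set_def by blast
  then have "suitable \<pi> r" if "quantifier_rule r" for r
    using that acyc assms(2) \<pi>(2) by (auto simp: suitable_def quantifier_rule_def)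
  then have "LJpp_proof \<pi>" using \<pi>(1) by (simp add: LJpp_proof_def)
  moreover have "cut_free \<pi>" using \<pi>(3) by (auto simp: cut_free_def)
  ultimately show ?thesis using \<pi>(2) by blast
qed

section \<open>Substitution for dangling indices\<close>

text \<open>Parallel substitution by an environment: \<open>e 0\<close> replaces the innermost
  dangling index. The values are not shifted under quantifiers, so it is meant for environments of
  terms without dangling indices.\<close>

primrec sub_tm :: "nat \<Rightarrow> (nat \<Rightarrow> 'f tm) \<Rightarrow> 'f tm \<Rightarrow> 'f tm" where
  "sub_tm k e (Free a) = Free a"
| "sub_tm k e (Bound i) = (if i < k then Bound i else e (i - k))"
| "sub_tm k e (Fun h ts) = Fun h (map (sub_tm k e) ts)"

primrec sub :: "nat \<Rightarrow> (nat \<Rightarrow> 'f tm) \<Rightarrow> ('f, 'p) fm \<Rightarrow> ('f, 'p) fm" where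
  "sub k e Bot = Bot"
| "sub k e (Pre p ts) = Pre p (map (sub_tm k e) ts)"
| "sub k e (And A B) = And (sub k e A) (sub k e B)"
| "sub k e (Or A B) = Or (sub k e A) (sub k e B)"
| "sub k e (Imp A B) = Imp (sub k e A) (sub k e B)"
| "sub k e (All A) = All (sub (Suc k) e A)"
| "sub k e (Ex A) = Ex (sub (Suc k) e A)"

lemma lc_tm_mono: "lc_tm k t \<Longrightarrow> k \<le> l \<Longrightarrow> lc_tm l t"
  by (induction t) (auto simp: list_all_iff)

lemma inst_tm_lc: "lc_tm k s \<Longrightarrow> inst_tm k t s = s"
  by (induction s) (auto simp: list_all_iff map_idI)

lemma shift_tm_lc: "lc_tm 0 t \<Longrightarrow> shift_tm k t = t"
  by (induction t) (auto simp: list_all_iff map_idI)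

lemma sub_tm_lc: "lc_tm k t \<Longrightarrow> sub_tm k e t = t"
  by (induction t) (auto simp: list_all_iff map_idI)

lemma sub_lc: "lc k A \<Longrightarrow> sub k e A = A"
  by (induction A arbitrary: k) (auto simp: list_all_iff map_idI sub_tm_lc)

lemma lc_tm_sub_tm:
  "lc_tm (k + n) t \<Longrightarrow> \<forall>i. lc_tm 0 (e i) \<Longrightarrow> lc_tm k (sub_tm k e t)"
  by (induction t) (auto simp: list_all_iff intro: lc_tm_mono)

lemma lc_sub: "lc (k + n) A \<Longrightarrow> \<forall>i. lc_tm 0 (e i) \<Longrightarrow> lc k (sub k e A)"
  by (induction A arbitrary: k) (fastforce simp: list_all_iff intro: lc_tm_sub_tm)+

lemma fv_tm_sub_tm:
  "lc_tm (k + n) t \<Longrightarrow> fv_tm (sub_tm k e t) \<subseteq> fv_tm t \<union> (\<Union>i<n. fv_tm (e i))"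
proof (induction t)
  case (Bound i)
  then show ?case by (auto intro!: bexI[of _ "i - k"])
qed (fastforce simp: list_all_iff)+

lemma fv_sub: "lc (k + n) A \<Longrightarrow> fv (sub k e A) \<subseteq> fv A \<union> (\<Union>i<n. fv_tm (e i))"
proof (induction A arbitrary: k)
  case (Pre p ts)
  then show ?case using fv_tm_sub_tm[of k n _ e] by (fastforce simp: list_all_iff)
next
  case (All A)
  then show ?case using All.IH[of "Suc k"] by simp
next
  case (Ex A)
  then show ?case using Ex.IH[of "Suc k"] by simp
qed (auto | fastforce)+

lemma sub_tm_cong:
  "lc_tm (k + n) t \<Longrightarrow> (\<And>i. i < n \<Longrightarrow> e i = e' i) \<Longrightarrow> sub_tm k e t = sub_tm k e' t"
  by (induction t) (auto simp: list_all_iff)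

lemma sub_cong:
  "lc (k + n) A \<Longrightarrow> (\<And>i. i < n \<Longrightarrow> e i = e' i) \<Longrightarrow> sub k e A = sub k e' A"
  by (induction A arbitrary: k) (auto simp: list_all_iff intro: sub_tm_cong)

lemma funs_tm_sub_tm:
  "funs_tm t \<subseteq> K \<Longrightarrow> \<forall>i. funs_tm (e i) \<subseteq> K \<Longrightarrow> funs_tm (sub_tm k e t) \<subseteq> K"
  by (induction t) (auto simp: UN_subset_iff)

lemma funs_sub: "funs A \<subseteq> K \<Longrightarrow> \<forall>i. funs_tm (e i) \<subseteq> K \<Longrightarrow> funs (sub k e A) \<subseteq> K"
  by (induction A arbitrary: k) (simp_all add: UN_subset_iff funs_tm_sub_tm)

lemma inst_tm_sub_tm:
  assumes "lc_tm 0 t" and "\<forall>i. lc_tm 0 (e i)"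
  shows "inst_tm k t (sub_tm (Suc k) e s) = sub_tm k (case_nat t e) s"
proof (induction s)
  case (Bound i)
  have "inst_tm k t (e j) = e j" for j
    using assms(2) lc_tm_mono[of 0 "e j" k] by (simp add: inst_tm_lc)
  moreover have "i - Suc k = j" if "i - k = Suc j" for j using that by simp
  ultimately show ?case
    using assms(1) by (auto simp: shift_tm_lc split: nat.split)
qed auto

text \<open>Instantiating a weak quantifier pushes its term onto the environment. Since the values
  of \<open>e\<close> have no dangling indices, the instantiation does not touch them.\<close>

lemma inst_sub:
  assumes "lc_tm 0 t" and "\<forall>i. lc_tm 0 (e i)"
  shows "inst k t (sub (Suc k) e A) = sub k (case_nat t e) A"
  by (induction A arbitrary: k) (auto simp: inst_tm_sub_tm assms)

lemma sub_tm_shift_tm: "sub_tm k e (shift_tm k s) = sub_tm 0 e s"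
  by (induction s) auto

lemma sub_tm_inst_tm:
  "sub_tm k e (inst_tm k s u) = sub_tm k (case_nat (sub_tm 0 e s) e) u"
proof (induction u)
  case (Bound i)
  have "i - Suc k = j" if "i - k = Suc j" for j using that by simp
  then show ?case
    by (auto simp: sub_tm_shift_tm split: nat.split)
qed auto

text \<open>Here \<open>s\<close> may have dangling indices. The intended case is the Skolem term
  inserted by \<open>skolem_first\<close>, whose arguments are exactly such indices and are filled
  in by \<open>e\<close>.\<close>

lemma sub_inst: "sub k e (inst k s A) = sub k (case_nat (sub_tm 0 e s) e) A"
  by (induction A arbitrary: k) (auto simp: sub_tm_inst_tm)

section \<open>Skolem functions and Skolem terms\<close>

text \<open>Runs the same search as \<open>skolem_first\<close> and returns the subformula headed by
  the quantifier deleted there, with dangling indices for the weak quantifiers above it. The value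
  is meaningful only under \<open>has_strong p A\<close>.\<close>

primrec first_strong :: "bool \<Rightarrow> ('f, 'p) fm \<Rightarrow> ('f, 'p) fm" where
  "first_strong p Bot = Bot"
| "first_strong p (Pre q ts) = Pre q ts"
| "first_strong p (And A B) = (if has_strong p A then first_strong p A else first_strong p B)"
| "first_strong p (Or A B) = (if has_strong p A then first_strong p A else first_strong p B)"
| "first_strong p (Imp A B) =
    (if has_strong (\<not> p) A then first_strong (\<not> p) A else first_strong p B)"
| "first_strong p (All A) = (if p then All A else first_strong p A)"
| "first_strong p (Ex A) = (if \<not> p then Ex A else first_strong p A)"

lemma fv_first_strong: "fv (first_strong p A) \<subseteq> fv A"
  by (induction A arbitrary: p) auto

lemma funs_tm_shift_tm: "funs_tm (shift_tm k t) = funs_tm t"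
  by (induction t) auto

lemma fv_tm_shift_tm: "fv_tm (shift_tm k t) = fv_tm t"
  by (induction t) auto

lemma lc_tm_shift_tm: "lc_tm n t \<Longrightarrow> lc_tm (n + k) (shift_tm k t)"
  by (induction t) (auto simp: list_all_iff)

lemma funs_tm_inst_tm: "funs_tm (inst_tm k t s) \<subseteq> funs_tm s \<union> funs_tm t"
  by (induction s) (auto simp: funs_tm_shift_tm)

lemma fv_tm_inst_tm: "fv_tm (inst_tm k t s) \<subseteq> fv_tm s \<union> fv_tm t"
  by (induction s) (auto simp: fv_tm_shift_tm)

lemma lc_tm_inst_tm: "lc_tm (Suc (n + k)) s \<Longrightarrow> lc_tm n t \<Longrightarrow> lc_tm (n + k) (inst_tm k t s)"
  by (induction s) (auto simp: list_all_iff lc_tm_shift_tm)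

lemma funs_inst: "funs (inst k t A) \<subseteq> funs A \<union> funs_tm t"
proof (induction A arbitrary: k)
  case (Pre p ts)
  then show ?case using funs_tm_inst_tm[of k t] by fastforce
qed (auto | fastforce)+

lemma fv_inst: "fv (inst k t A) \<subseteq> fv A \<union> fv_tm t"
proof (induction A arbitrary: k)
  case (Pre p ts)
  then show ?case using fv_tm_inst_tm[of k t] by fastforce
qed (auto | fastforce)+

lemma lc_inst: "lc (Suc (n + k)) A \<Longrightarrow> lc_tm n t \<Longrightarrow> lc (n + k) (inst k t A)"
proof (induction A arbitrary: k)
  case (All A)
  then show ?case using All.IH[of "Suc k"] by simp
next
  case (Ex A)
  then show ?case using Ex.IH[of "Suc k"] by simp
qed (auto simp: list_all_iff lc_tm_inst_tm)

lemma funs_skolem_first: "funs (skolem_first p n f A) \<subseteq> insert f (funs A)"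
proof (induction A arbitrary: p n)
  case (All A)
  then show ?case using funs_inst[of 0 "Fun f (map Bound (rev [0..<n]))" A] by auto
next
  case (Ex A)
  then show ?case using funs_inst[of 0 "Fun f (map Bound (rev [0..<n]))" A] by auto
qed (auto | fastforce)+

lemma fv_skolem_first: "fv (skolem_first p n f A) \<subseteq> fv A"
proof (induction A arbitrary: p n)
  case (All A)
  then show ?case using fv_inst[of 0 "Fun f (map Bound (rev [0..<n]))" A] by auto
next
  case (Ex A)
  then show ?case using fv_inst[of 0 "Fun f (map Bound (rev [0..<n]))" A] by auto
qed (auto | fastforce)+

lemma lc_skolem_first: "lc n A \<Longrightarrow> lc n (skolem_first p n f A)"
proof (induction A arbitrary: p n)
  case (All A)
  then show ?case
    using lc_inst[of n 0 A "Fun f (map Bound (rev [0..<n]))"] by (auto simp: list_all_iff)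
next
  case (Ex A)
  then show ?case
    using lc_inst[of n 0 A "Fun f (map Bound (rev [0..<n]))"] by (auto simp: list_all_iff)
qed auto

text \<open>Doubling the names of the old variables makes room for the odd names, which stand for the
  Skolem terms. Bound variables inside a Skolem term are lost; therefore the translation commutes
  with substitution only on formulas whose Skolem terms are closed.\<close>

primrec tr_tm :: "('f tm \<Rightarrow> nat) \<Rightarrow> 'f \<Rightarrow> 'f tm \<Rightarrow> 'f tm" where
  "tr_tm c f (Free a) = Free (2 * a)"
| "tr_tm c f (Bound i) = Bound i"
| "tr_tm c f (Fun h ts) =
    (if h = f then Free (Suc (2 * c (Fun h ts))) else Fun h (map (tr_tm c f) ts))"

primrec tr :: "('f tm \<Rightarrow> nat) \<Rightarrow> 'f \<Rightarrow> ('f, 'p) fm \<Rightarrow> ('f, 'p) fm" where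
  "tr c f Bot = Bot"
| "tr c f (Pre p ts) = Pre p (map (tr_tm c f) ts)"
| "tr c f (And A B) = And (tr c f A) (tr c f B)"
| "tr c f (Or A B) = Or (tr c f A) (tr c f B)"
| "tr c f (Imp A B) = Imp (tr c f A) (tr c f B)"
| "tr c f (All A) = All (tr c f A)"
| "tr c f (Ex A) = Ex (tr c f A)"

primrec skolem_closed_tm :: "'f \<Rightarrow> 'f tm \<Rightarrow> bool" where
  "skolem_closed_tm f (Free a) \<longleftrightarrow> True"
| "skolem_closed_tm f (Bound i) \<longleftrightarrow> True"
| "skolem_closed_tm f (Fun h ts) \<longleftrightarrow>
    (if h = f then list_all (lc_tm 0) ts else list_all (skolem_closed_tm f) ts)"

primrec skolem_closed :: "'f \<Rightarrow> ('f, 'p) fm \<Rightarrow> bool" where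
  "skolem_closed f Bot \<longleftrightarrow> True"
| "skolem_closed f (Pre p ts) \<longleftrightarrow> list_all (skolem_closed_tm f) ts"
| "skolem_closed f (And A B) \<longleftrightarrow> skolem_closed f A \<and> skolem_closed f B"
| "skolem_closed f (Or A B) \<longleftrightarrow> skolem_closed f A \<and> skolem_closed f B"
| "skolem_closed f (Imp A B) \<longleftrightarrow> skolem_closed f A \<and> skolem_closed f B"
| "skolem_closed f (All A) \<longleftrightarrow> skolem_closed f A"
| "skolem_closed f (Ex A) \<longleftrightarrow> skolem_closed f A"

lemma lc_tm_tr_tm: "lc_tm k t \<Longrightarrow> lc_tm k (tr_tm c f t)"
  by (induction t) (auto simp: list_all_iff)

lemma lc_tr: "lc k A \<Longrightarrow> lc k (tr c f A)"
  by (induction A arbitrary: k) (auto simp: list_all_iff lc_tm_tr_tm)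

lemma funs_tm_tr_tm: "funs_tm (tr_tm c f t) \<subseteq> funs_tm t"
  by (induction t) auto

lemma funs_tr: "funs (tr c f A) \<subseteq> funs A"
  using funs_tm_tr_tm by (induction A) fastforce+

lemma tr_tm_id: "fv_tm t = {} \<Longrightarrow> f \<notin> funs_tm t \<Longrightarrow> tr_tm c f t = t"
  by (induction t) (auto simp: map_idI)

text \<open>Closedness enters because even names of old variables are changed by doubling. This
  keeps the untouched formulas of the end-sequent fixed.\<close>

lemma tr_id: "fv A = {} \<Longrightarrow> f \<notin> funs A \<Longrightarrow> tr c f A = A"
  by (induction A) (auto simp: map_idI tr_tm_id)

lemma skolem_closed_tm_lc: "lc_tm 0 t \<Longrightarrow> skolem_closed_tm f t"
  by (induction t) (auto simp: list_all_iff)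

lemma skolem_closed_tm_inst_tm:
  "skolem_closed_tm f s \<Longrightarrow> lc_tm 0 t \<Longrightarrow> skolem_closed_tm f (inst_tm k t s)"
proof (induction s)
  case (Fun h ts)
  have "inst_tm k t u = u" if "lc_tm 0 u" for u
    using that lc_tm_mono[of 0 u k] by (simp add: inst_tm_lc)
  then show ?case using Fun by (auto simp: list_all_iff)
qed (auto simp: shift_tm_lc skolem_closed_tm_lc)

lemma skolem_closed_inst:
  "skolem_closed f A \<Longrightarrow> lc_tm 0 t \<Longrightarrow> skolem_closed f (inst k t A)"
  by (induction A arbitrary: k) (auto simp: list_all_iff skolem_closed_tm_inst_tm)

lemma tr_tm_inst_tm:
  "skolem_closed_tm f s \<Longrightarrow> lc_tm 0 t \<Longrightarrow>
    tr_tm c f (inst_tm k t s) = inst_tm k (tr_tm c f t) (tr_tm c f s)"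
proof (induction s)
  case (Fun h ts)
  show ?case
  proof (cases "h = f")
    case True
    have "inst_tm k t u = u" if "lc_tm 0 u" for u
      using that lc_tm_mono[of 0 u k] by (simp add: inst_tm_lc)
    then have "map (inst_tm k t) ts = ts"
      using Fun.prems True by (auto simp: list_all_iff map_idI)
    then show ?thesis using True by simp
  next
    case False
    then show ?thesis using Fun by (auto simp: list_all_iff)
  qed
qed (auto simp: shift_tm_lc lc_tm_tr_tm)

text \<open>In a skolem-closed formula an instantiation never reaches into a Skolem term, so the
  name of that term is the same before and after.\<close>

lemma tr_inst:
  "skolem_closed f A \<Longrightarrow> lc_tm 0 t \<Longrightarrow>
    tr c f (inst k t A) = inst k (tr_tm c f t) (tr c f A)"
  by (induction A arbitrary: k) (auto simp: list_all_iff tr_tm_inst_tm)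

lemma tr_tm_sub_tm:
  "f \<notin> funs_tm t \<Longrightarrow> fv_tm t = {} \<Longrightarrow> tr_tm c f (sub_tm k e t) = sub_tm k (tr_tm c f \<circ> e) t"
  by (induction t) auto

text \<open>All Skolem terms of the result lie inside values of \<open>e\<close>, so translating
  these values is enough.\<close>

lemma tr_sub:
  "f \<notin> funs A \<Longrightarrow> fv A = {} \<Longrightarrow> tr c f (sub k e A) = sub k (tr_tm c f \<circ> e) A"
  by (induction A arbitrary: k) (auto simp: tr_tm_sub_tm)

lemma skolem_closed_tm_sub_tm:
  "f \<notin> funs_tm t \<Longrightarrow> \<forall>i. lc_tm 0 (e i) \<Longrightarrow> skolem_closed_tm f (sub_tm k e t)"
  by (induction t) (auto simp: list_all_iff skolem_closed_tm_lc)

lemma skolem_closed_sub: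
  "f \<notin> funs A \<Longrightarrow> \<forall>i. lc_tm 0 (e i) \<Longrightarrow> skolem_closed f (sub k e A)"
  by (induction A arbitrary: k) (auto simp: list_all_iff skolem_closed_tm_sub_tm)

section \<open>Numbering terms monotonically in the subterm order\<close>

primrec enc_tm :: "('f \<Rightarrow> nat) \<Rightarrow> 'f tm \<Rightarrow> nat" where
  "enc_tm g (Free a) = prod_encode (0, a)"
| "enc_tm g (Bound i) = prod_encode (1, i)"
| "enc_tm g (Fun h ts) = prod_encode (2, prod_encode (g h, list_encode (map (enc_tm g) ts)))"

lemma less_list_encode: "x \<in> set xs \<Longrightarrow> x < list_encode xs"
proof (induction xs)
  case (Cons y xs)
  then show ?case
    using le_prod_encode_1[of y "list_encode xs"] le_prod_encode_2[of "list_encode xs" y] by auto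
qed simp

lemma enc_tm_subterm: "u \<in> set ts \<Longrightarrow> enc_tm g u < enc_tm g (Fun h ts)"
proof -
  assume "u \<in> set ts"
  then have "enc_tm g u < list_encode (map (enc_tm g) ts)" by (intro less_list_encode) simp
  also have "\<dots> \<le> prod_encode (g h, list_encode (map (enc_tm g) ts))" by (rule le_prod_encode_2)
  also have "\<dots> \<le> enc_tm g (Fun h ts)" by (simp add: le_prod_encode_2)
  finally show ?thesis .
qed

lemma enc_tm_inject:
  assumes "inj_on g K"
  shows "funs_tm t \<subseteq> K \<Longrightarrow> funs_tm s \<subseteq> K \<Longrightarrow> enc_tm g t = enc_tm g s \<Longrightarrow> t = s"
proof (induction t arbitrary: s)
  case (Fun h ts)
  then obtain h' ss where s: "s = Fun h' ss"
    by (cases s) auto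
  have "h = h'"
    using Fun.prems s assms by (auto dest: inj_onD)
  moreover have "ts = ss"
  proof (rule list.inj_map_strong)
    show "map (enc_tm g) ts = map (enc_tm g) ss" using Fun.prems s by (simp add: list_encode_eq)
    show "z = y" if "z \<in> set ts" "y \<in> set ss" "enc_tm g z = enc_tm g y" for z y
      using Fun.IH[of z y] Fun.prems s that by (auto simp: UN_subset_iff)
  qed
  ultimately show ?case using s by simp
next
  case (Free a)
  then show ?case by (cases s) auto
next
  case (Bound i)
  then show ?case by (cases s) auto
qed

text \<open>The type of function symbols may be uncountable, so injectivity is possible only over
  finitely many of them. Growth along subterms comes from the pairing functions and holds for all
  terms.\<close>

lemma ex_term_code:
  fixes K :: "'f set"
  assumes "finite K"
  shows "\<exists>c :: 'f tm \<Rightarrow> nat. inj_on c {t. funs_tm t \<subseteq> K} \<and>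
    (\<forall>h ts. \<forall>u\<in>set ts. c u < c (Fun h ts))"
proof -
  obtain g :: "'f \<Rightarrow> nat" where "inj_on g K"
    using assms finite_imp_inj_to_nat_seg by blast
  then have "inj_on (enc_tm g) {t. funs_tm t \<subseteq> K}"
    by (intro inj_onI) (auto dest: enc_tm_inject)
  then show ?thesis
    by (intro exI[of _ "enc_tm g"] conjI allI ballI) (simp_all only: enc_tm_subterm)
qed

text \<open>Only outermost Skolem terms receive a name. The old variables inside such a term
  \<open>s\<close> disappear from the translation but remain hidden in the name; recording
  \<open>fv_tm s \<subseteq> fv_tm t\<close> is what later lets cycles be traced back to
  \<open>\<Sigma>\<close>.\<close>

lemma fv_tm_tr_tm:
  assumes "\<forall>h ts. \<forall>u\<in>set ts. c u < c (Fun h ts)" and "z \<in> fv_tm (tr_tm c f t)"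
  shows "(\<exists>a\<in>fv_tm t. z = 2 * a) \<or> (\<exists>s. z = Suc (2 * c s) \<and> fv_tm s \<subseteq> fv_tm t \<and>
    funs_tm s \<subseteq> funs_tm t \<and> c s \<le> c t)"
  using assms(2)
proof (induction t)
  case (Fun h ts)
  show ?case
  proof (cases "h = f")
    case True
    then show ?thesis using Fun.prems by (intro disjI2 exI[of _ "Fun h ts"]) simp
  next
    case False
    then obtain u where u: "u \<in> set ts" "z \<in> fv_tm (tr_tm c f u)" using Fun.prems by auto
    have "c u < c (Fun h ts)" using assms(1) u(1) by blast
    moreover have "fv_tm u \<subseteq> fv_tm (Fun h ts)" "funs_tm u \<subseteq> funs_tm (Fun h ts)"
      using u(1) by auto
    ultimately show ?thesis
      using Fun.IH[OF u] by (elim disjE bexE exE conjE) (blast, intro disjI2 exI conjI, assumption, auto)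
  qed
qed auto

lemma fv_tr:
  assumes "\<forall>h ts. \<forall>u\<in>set ts. c u < c (Fun h ts)" and "z \<in> fv (tr c f A)"
  shows "(\<exists>a\<in>fv A. z = 2 * a) \<or>
    (\<exists>s. z = Suc (2 * c s) \<and> fv_tm s \<subseteq> fv A \<and> funs_tm s \<subseteq> funs A)"
  using assms(2)
proof (induction A)
  case (Pre p ts)
  then obtain u where u: "u \<in> set ts" "z \<in> fv_tm (tr_tm c f u)" by auto
  have "fv_tm u \<subseteq> fv (Pre p ts)" "funs_tm u \<subseteq> funs (Pre p ts)"
    using u(1) by auto
  then show ?case
    using fv_tm_tr_tm[OF assms(1) u(2)]
    by (elim disjE bexE exE conjE) (blast, intro disjI2 exI conjI, assumption, auto)
qed (simp; blast)+

section \<open>Elimination of a Skolem function\<close>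

fun strong_headed :: "bool \<Rightarrow> ('f, 'p) fm \<Rightarrow> bool" where
  "strong_headed p (All A) = p"
| "strong_headed p (Ex A) = (\<not> p)"
| "strong_headed p _ = False"

text \<open>Distributes the replacements over the two contexts that \<open>ImpL\<close>
  merges.\<close>

lemma rel_mset_union_split:
  "rel_mset R (M + M') N \<Longrightarrow> \<exists>N1 N2. N = N1 + N2 \<and> rel_mset R M N1 \<and> rel_mset R M' N2"
proof (induction M arbitrary: N)
  case empty
  then show ?case by (auto intro: exI[of _ "{#}"] rel_mset_Zero)
next
  case (add x M)
  then obtain N' y where "N = add_mset y N'" "R x y" "rel_mset R (M + M') N'"
    by (auto dest: msed_rel_invL)
  then show ?case using add.IH by (metis rel_mset_Plus union_mset_add_mset_left)
qed

text \<open>\<open>Q\<close> is the subformula headed by the quantifier that \<open>f\<close>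
  replaced; its dangling indices belong to the dominating weak quantifiers. \<open>\<Sigma>\<close>
  belongs to the derivation before \<open>f\<close> is eliminated.\<close>

locale skolem_elimination =
  fixes c :: "'f tm \<Rightarrow> nat" and f :: 'f and K :: "'f set" and Q :: "('f, 'p) fm"
    and \<Sigma> :: "(nat \<times> ('f, 'p) fm) set"
  assumes c_inj: "inj_on c {t. funs_tm t \<subseteq> K}"
    and c_subterm: "\<forall>h ts. \<forall>u\<in>set ts. c u < c (Fun h ts)"
    and f_K: "f \<in> K" and funs_Q: "funs Q \<subseteq> K" and fv_Q: "fv Q = {}"
    and \<Sigma>_K: "\<And>a P. (a, P) \<in> \<Sigma> \<Longrightarrow> funs P \<subseteq> K"
    and suitable_\<Sigma>: "suitable_set \<Sigma>"
begin

section \<open>Strong inferences after the elimination and their acyclicity\<close>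

definition skolem_term :: "nat \<Rightarrow> (nat \<Rightarrow> 'f tm) \<Rightarrow> 'f tm" where
  "skolem_term n e = Fun f (map e (rev [0..<n]))"

definition new_strong :: "(nat \<times> ('f, 'p) fm) set" where
  "new_strong = {(2 * a, tr c f P) | a P. (a, P) \<in> \<Sigma>} \<union>
    {(Suc (2 * c (skolem_term n e)), sub 0 (tr_tm c f \<circ> e) Q) | n e.
      lc n Q \<and> (\<forall>i. funs_tm (e i) \<subseteq> K)}"

lemma funs_skolem_term: "\<forall>i. funs_tm (e i) \<subseteq> K \<Longrightarrow> funs_tm (skolem_term n e) \<subseteq> K"
  using f_K by (auto simp: skolem_term_def)

lemma c_skolem_term_eq:
  assumes "funs_tm s \<subseteq> K" and "\<forall>i. funs_tm (e i) \<subseteq> K" and "c s = c (skolem_term n e)"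
  shows "s = skolem_term n e"
  using inj_onD[OF c_inj assms(3)] assms(1) funs_skolem_term[OF assms(2)] by simp

lemma new_strong_even:
  assumes "(2 * a, P) \<in> new_strong"
  shows "\<exists>P'. (a, P') \<in> \<Sigma> \<and> P = tr c f P'"
proof -
  have "2 * a \<noteq> Suc (2 * m)" for m by presburger
  then show ?thesis using assms by (auto simp: new_strong_def)
qed

lemma new_strong_odd:
  assumes "(Suc (2 * m), P) \<in> new_strong"
  shows "\<exists>n e. m = c (skolem_term n e) \<and> P = sub 0 (tr_tm c f \<circ> e) Q \<and> lc n Q \<and>
    (\<forall>i. funs_tm (e i) \<subseteq> K)"
proof -
  have "Suc (2 * m) \<noteq> 2 * a" for a by presburger
  then show ?thesis using assms by (auto simp: new_strong_def)
qed

lemma funs_new_strong: "(a, P) \<in> new_strong \<Longrightarrow> funs P \<subseteq> K"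
proof -
  assume "(a, P) \<in> new_strong"
  then consider P' where "(a div 2, P') \<in> \<Sigma>" "P = tr c f P'"
    | e where "P = sub 0 (tr_tm c f \<circ> e) Q" "\<forall>i. funs_tm (e i) \<subseteq> K"
    by (auto simp: new_strong_def)
  then show ?thesis
  proof cases
    case 1
    then show ?thesis using \<Sigma>_K funs_tr by fast
  next
    case 2
    have "funs_tm ((tr_tm c f \<circ> e) i) \<subseteq> K" for i
      using 2(2) funs_tm_tr_tm[of c f "e i"] by fastforce
    then show ?thesis using 2(1) funs_Q funs_sub by blast
  qed
qed

text \<open>For odd names, injectivity of \<open>c\<close> recovers the Skolem term; its argument
  list gives \<open>n\<close> by its length and the values of \<open>e\<close> below
  \<open>n\<close>, and \<open>Q\<close> sees nothing else.\<close>

lemma functional_new_strong: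
  assumes "(a, P) \<in> new_strong" and "(a, P') \<in> new_strong"
  shows "P = P'"
proof (cases "even a")
  case True
  then obtain b where "a = 2 * b" by blast
  then show ?thesis
    using assms suitable_\<Sigma> by (auto simp: suitable_set_def dest!: new_strong_even)
next
  case False
  then obtain m where a: "a = Suc (2 * m)" by (auto elim: oddE)
  obtain n e where e: "m = c (skolem_term n e)" "P = sub 0 (tr_tm c f \<circ> e) Q" "lc n Q"
      "\<forall>i. funs_tm (e i) \<subseteq> K"
    using new_strong_odd assms(1) a by blast
  obtain n' e' where e': "m = c (skolem_term n' e')" "P' = sub 0 (tr_tm c f \<circ> e') Q"
      "lc n' Q" "\<forall>i. funs_tm (e' i) \<subseteq> K"
    using new_strong_odd assms(2) a by blast
  have "skolem_term n e = skolem_term n' e'"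
    using c_skolem_term_eq funs_skolem_term e e' by metis
  then have eq: "map e (rev [0..<n]) = map e' (rev [0..<n'])"
    by (simp add: skolem_term_def)
  then have "n = n'" using map_eq_imp_length_eq by fastforce
  then have "e i = e' i" if "i < n" for i
    using eq that by auto
  then show ?thesis
    using e(2,3) e'(2) sub_cong[of 0 n Q "tr_tm c f \<circ> e" "tr_tm c f \<circ> e'"] by simp
qed

text \<open>As \<open>Q\<close> has no free variables, those of its instance come from translated
  arguments of \<open>s\<close>. These arguments are proper subterms, whence the strict decrease of
  \<open>c\<close>.\<close>

lemma skolem_variable_dependencies:
  assumes "(Suc (2 * c s), z) \<in> dependencies new_strong" and "funs_tm s \<subseteq> K"
  shows "(\<exists>b\<in>fv_tm s. z = 2 * b) \<or>
    (\<exists>s'. z = Suc (2 * c s') \<and> fv_tm s' \<subseteq> fv_tm s \<and> funs_tm s' \<subseteq> K \<and> c s' < c s)"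
proof -
  obtain P where P: "(Suc (2 * c s), P) \<in> new_strong" "z \<in> fv P"
    using assms(1) by (auto simp: dependencies_def)
  then obtain n e where e: "c s = c (skolem_term n e)" "P = sub 0 (tr_tm c f \<circ> e) Q"
      "lc n Q" "\<forall>i. funs_tm (e i) \<subseteq> K"
    using new_strong_odd by blast
  then have s: "s = Fun f (map e (rev [0..<n]))"
    using c_skolem_term_eq assms(2) by (simp add: skolem_term_def)
  obtain i where i: "i < n" "z \<in> fv_tm (tr_tm c f (e i))"
    using fv_sub[of 0 n Q "tr_tm c f \<circ> e"] e P(2) fv_Q by auto
  have "e i \<in> set (map e (rev [0..<n]))" using i(1) by simp
  then have "c (e i) < c s" and "fv_tm (e i) \<subseteq> fv_tm s"
    using c_subterm s by (blast, auto)
  moreover have "funs_tm (e i) \<subseteq> K" using e(4) by blast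
  ultimately show ?thesis
    using fv_tm_tr_tm[OF c_subterm i(2)]
    by (elim disjE bexE exE conjE) (blast, intro disjI2 exI conjI, assumption, auto)
qed

text \<open>The invariant treats the name of a Skolem term as standing for all old variables inside
  that term. Leaving such a name leads only to those variables or to names hiding a subset of them,
  so every path from an old variable projects to paths of \<open>\<Sigma>\<close>.\<close>

lemma old_variable_reaches:
  assumes "(2 * a, z) \<in> (dependencies new_strong)\<^sup>+"
  shows "(\<exists>b. z = 2 * b \<and> (a, b) \<in> (dependencies \<Sigma>)\<^sup>+) \<or>
    (\<exists>s. z = Suc (2 * c s) \<and> funs_tm s \<subseteq> K \<and> (\<forall>b\<in>fv_tm s. (a, b) \<in> (dependencies \<Sigma>)\<^sup>+))"
proof -
  have edge: "(\<exists>b. z = 2 * b \<and> (a, b) \<in> dependencies \<Sigma>) \<or>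
    (\<exists>s. z = Suc (2 * c s) \<and> funs_tm s \<subseteq> K \<and> (\<forall>b\<in>fv_tm s. (a, b) \<in> dependencies \<Sigma>))"
    if az: "(2 * a, z) \<in> dependencies new_strong" for a z
  proof -
    obtain P where P: "(2 * a, P) \<in> new_strong" "z \<in> fv P"
      using az by (auto simp: dependencies_def)
    then obtain P' where P': "(a, P') \<in> \<Sigma>" "P = tr c f P'"
      using new_strong_even by blast
    have "(a, b) \<in> dependencies \<Sigma>" if "b \<in> fv P'" for b
      using that P'(1) by (auto simp: dependencies_def)
    moreover have "funs P' \<subseteq> K" using \<Sigma>_K P'(1) by blast
    moreover have "z \<in> fv (tr c f P')" using P(2) P'(2) by simp
    note fv_tr[OF c_subterm this]
    ultimately show ?thesis
      by (elim disjE bexE exE conjE) (blast, intro disjI2 exI conjI, assumption, auto)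
  qed
  show ?thesis
    using assms
  proof (induction rule: trancl_induct)
    case (base z)
    then show ?case using edge[of a z] by blast
  next
    case (step y z)
    from step.IH show ?case
    proof (elim disjE exE conjE)
      fix b assume "y = 2 * b" "(a, b) \<in> (dependencies \<Sigma>)\<^sup>+"
      moreover have "(2 * b, z) \<in> dependencies new_strong"
        using step.hyps(2) \<open>y = 2 * b\<close> by simp
      ultimately show ?thesis using edge[of b z] by (blast intro: trancl_into_trancl)
    next
      fix s assume s: "y = Suc (2 * c s)" "funs_tm s \<subseteq> K"
        "\<forall>b\<in>fv_tm s. (a, b) \<in> (dependencies \<Sigma>)\<^sup>+"
      have "(Suc (2 * c s), z) \<in> dependencies new_strong"
        using step.hyps(2) s(1) by simp
      then show ?thesis
        using skolem_variable_dependencies[of s z] s(2,3) by blast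
    qed
  qed
qed

text \<open>A step between two odd names lowers the name. Hence a path that does not strictly
  decrease from an odd name has met an even one, which reduces odd cycles to even ones.\<close>

lemma skolem_variable_descent:
  assumes "(x, z) \<in> (dependencies new_strong)\<^sup>+" and "odd x"
  shows "z < x \<and> odd z \<or>
    (\<exists>y. even y \<and> (x, y) \<in> (dependencies new_strong)\<^sup>+ \<and> (y, z) \<in> (dependencies new_strong)\<^sup>*)"
proof -
  have edge: "even z \<or> z < x" if xz: "(x, z) \<in> dependencies new_strong" "odd x" for x z
  proof -
    obtain m where x: "x = Suc (2 * m)" using xz(2) by (auto elim: oddE)
    obtain P where P: "(Suc (2 * m), P) \<in> new_strong"
      using xz(1) x by (auto simp: dependencies_def)
    then obtain n e where "m = c (skolem_term n e)" "\<forall>i. funs_tm (e i) \<subseteq> K"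
      using new_strong_odd by blast
    then show ?thesis
      using skolem_variable_dependencies[of "skolem_term n e" z] xz(1) x
        funs_skolem_term[of e n] by fastforce
  qed
  show ?thesis
    using assms(1)
  proof (induction rule: trancl_induct)
    case (base z)
    then show ?case using edge[of x z] assms(2) by blast
  next
    case (step y z)
    from step.IH show ?case
    proof
      assume y: "y < x \<and> odd y"
      then have "even z \<or> z < x" using edge[of y z] step.hyps(2) by auto
      then show ?thesis using step.hyps by (meson rtrancl.rtrancl_refl trancl.trancl_into_trancl)
    next
      assume "\<exists>y'. even y' \<and> (x, y') \<in> (dependencies new_strong)\<^sup>+ \<and>
        (y', y) \<in> (dependencies new_strong)\<^sup>*"
      then show ?thesis using step.hyps(2) by (meson rtrancl.rtrancl_into_rtrancl)
    qed
  qed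
qed

lemma suitable_new_strong: "suitable_set new_strong"
proof -
  have even_case: "(x, x) \<notin> (dependencies new_strong)\<^sup>+" if ev: "even x" for x
  proof
    assume x: "(x, x) \<in> (dependencies new_strong)\<^sup>+"
    obtain a where a: "x = 2 * a" using ev by blast
    have "2 * a \<noteq> Suc (2 * m)" for m by presburger
    then have "(a, a) \<in> (dependencies \<Sigma>)\<^sup>+"
      using old_variable_reaches[of a x] x a by auto
    then show False using suitable_\<Sigma> by (auto simp: suitable_set_def acyclic_def)
  qed
  have "(x, x) \<notin> (dependencies new_strong)\<^sup>+" for x
  proof
    assume x: "(x, x) \<in> (dependencies new_strong)\<^sup>+"
    then have "odd x" using even_case by blast
    \<comment> \<open>With \<open>z = x\<close> the descent alternative is impossible, so the cycle
      contains an even \<open>y\<close>, which then lies on a cycle itself.\<close>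
    then obtain y where "even y" "(x, y) \<in> (dependencies new_strong)\<^sup>+"
        "(y, x) \<in> (dependencies new_strong)\<^sup>*"
      using skolem_variable_descent[OF x] by auto
    then show False using even_case by (meson rtrancl_trancl_trancl)
  qed
  then show ?thesis
    using functional_new_strong by (auto simp: suitable_set_def acyclic_def)
qed

section \<open>Replacements for formula occurrences\<close>

definition tracked :: "bool \<Rightarrow> nat \<Rightarrow> (nat \<Rightarrow> 'f tm) \<Rightarrow> ('f, 'p) fm \<Rightarrow> bool" where
  "tracked p n e A \<longleftrightarrow> has_strong p A \<and> f \<notin> funs A \<and> fv A = {} \<and> lc n A \<and>
    first_strong p A = Q \<and> (\<forall>i. lc_tm 0 (e i)) \<and> (\<forall>i. funs_tm (e i) \<subseteq> K)"

text \<open>\<open>source p B G\<close>: the occurrence of \<open>B\<close> in the given derivation is to be replaced by \<open>G\<close>. Either the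
  Skolemized quantifier does not occur below \<open>B\<close>, or \<open>B\<close> is the instance of the Skolemization
  of a subformula \<open>A\<close> of the end-sequent with the terms \<open>e\<close> for the weak quantifiers above it.\<close>

definition source :: "bool \<Rightarrow> ('f, 'p) fm \<Rightarrow> ('f, 'p) fm \<Rightarrow> bool" where
  "source p B G \<longleftrightarrow> skolem_closed f B \<and> G = tr c f B \<or>
    (\<exists>A n e. tracked p n e A \<and> B = sub 0 e (skolem_first p n f A) \<and>
      G = sub 0 (tr_tm c f \<circ> e) A)"

text \<open>The situation above the reinserted inference: the deleted quantifier no longer heads the
  replacement, so \<open>B\<close> and \<open>G\<close> have the same outermost connective and an
  inference on \<open>B\<close> can be repeated on \<open>G\<close>.\<close>

definition reduced_source :: "bool \<Rightarrow> ('f, 'p) fm \<Rightarrow> ('f, 'p) fm \<Rightarrow> bool" where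
  "reduced_source p B G \<longleftrightarrow> skolem_closed f B \<and> G = tr c f B \<or>
    (\<exists>A n e. tracked p n e A \<and> \<not> strong_headed p A \<and> B = sub 0 e (skolem_first p n f A) \<and>
      G = sub 0 (tr_tm c f \<circ> e) A)"

lemma source_of_reduced: "reduced_source p B G \<Longrightarrow> source p B G"
  unfolding reduced_source_def source_def by blast

lemma source_plain: "skolem_closed f B \<Longrightarrow> source p B (tr c f B)"
  by (simp add: source_def)

lemma source_tracked:
  "tracked p n e A \<Longrightarrow> source p (sub 0 e (skolem_first p n f A)) (sub 0 (tr_tm c f \<circ> e) A)"
  unfolding source_def by blast

text \<open>Covers the neighbours of a tracked subformula: \<open>f\<close> enters them only through
  the values of \<open>e\<close>, so all their Skolem terms are closed.\<close>

lemma source_untracked: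
  "f \<notin> funs A \<Longrightarrow> fv A = {} \<Longrightarrow> \<forall>i. lc_tm 0 (e i) \<Longrightarrow>
    source p (sub 0 e A) (sub 0 (tr_tm c f \<circ> e) A)"
  using source_plain[of "sub 0 e A" p] by (simp add: skolem_closed_sub tr_sub)

lemma lc_source:
  assumes "source p B G" and "lc 0 B"
  shows "lc 0 G"
proof -
  have "lc 0 (sub 0 (tr_tm c f \<circ> e) A)" if "tracked p n e A" for n e A
    using that lc_sub[of 0 n A "tr_tm c f \<circ> e"] by (simp add: tracked_def lc_tm_tr_tm)
  then show ?thesis using assms by (auto simp: source_def lc_tr)
qed

lemma tr_comp_case_nat: "tr_tm c f \<circ> case_nat t e = case_nat (tr_tm c f t) (tr_tm c f \<circ> e)"
  by (auto simp: fun_eq_iff split: nat.split)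

text \<open>The eigenvariable of the reinserted inference is the name of the Skolem term.\<close>

lemma tracked_strong_instance:
  assumes A: "tracked p n e A" "A = All Y \<and> p \<or> A = Ex Y \<and> \<not> p"
  shows "\<exists>a. (a, sub 0 (tr_tm c f \<circ> e) A) \<in> new_strong \<and>
    skolem_closed f (sub 0 e (skolem_first p n f A)) \<and>
    tr c f (sub 0 e (skolem_first p n f A)) = inst 0 (Free a) (sub 1 (tr_tm c f \<circ> e) Y)"
proof (intro exI conjI)
  let ?s = "skolem_term n e"
  let ?e = "case_nat ?s e"
  have e: "\<forall>i. lc_tm 0 (e i)" "\<forall>i. funs_tm (e i) \<subseteq> K" and Y: "f \<notin> funs Y" "fv Y = {}"
    and Q: "A = Q" "lc n Q"
    using A by (auto simp: tracked_def)
  show "(Suc (2 * c ?s), sub 0 (tr_tm c f \<circ> e) A) \<in> new_strong"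
    using Q e(2) unfolding new_strong_def by blast
  have "sub_tm 0 e (Fun f (map Bound (rev [0..<n]))) = ?s"
    by (simp add: skolem_term_def)
  moreover have "skolem_first p n f A = inst 0 (Fun f (map Bound (rev [0..<n]))) Y"
    using A(2) by auto
  ultimately have B: "sub 0 e (skolem_first p n f A) = sub 0 ?e Y"
    by (simp only: sub_inst)
  have "\<forall>i. lc_tm 0 (?e i)"
    using e(1) by (auto simp: skolem_term_def list_all_iff split: nat.split)
  then show "skolem_closed f (sub 0 e (skolem_first p n f A))"
    using B Y(1) by (simp add: skolem_closed_sub)
  have "tr_tm c f ?s = Free (Suc (2 * c ?s))"
    by (simp add: skolem_term_def)
  then show "tr c f (sub 0 e (skolem_first p n f A)) =
      inst 0 (Free (Suc (2 * c ?s))) (sub 1 (tr_tm c f \<circ> e) Y)"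
    using B Y e(1) by (simp add: tr_sub tr_comp_case_nat inst_sub lc_tm_tr_tm)
qed

text \<open>Once all weak quantifiers above the deleted one are instantiated, the Skolem term is
  closed and \<open>B\<close> becomes a plain formula. Polarity decides whether \<open>AllR\<close>
  or \<open>ExL\<close> restores the quantifier.\<close>

lemma source_cases:
  assumes "source p B G"
  obtains "reduced_source p B G"
  | a Y where "p" "G = All Y" "(a, All Y) \<in> new_strong"
      "reduced_source p B (inst 0 (Free a) Y)"
  | a Y where "\<not> p" "G = Ex Y" "(a, Ex Y) \<in> new_strong"
      "reduced_source p B (inst 0 (Free a) Y)"
proof (cases "reduced_source p B G")
  case True
  then show ?thesis by (rule that(1))
next
  case False
  then obtain A n e where A: "tracked p n e A" "strong_headed p A"
      "B = sub 0 e (skolem_first p n f A)" "G = sub 0 (tr_tm c f \<circ> e) A"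
    using assms unfolding source_def reduced_source_def by blast
  then obtain Y where Y: "A = All Y \<and> p \<or> A = Ex Y \<and> \<not> p"
    by (cases A) auto
  obtain a where a: "(a, G) \<in> new_strong" "skolem_closed f B"
      "tr c f B = inst 0 (Free a) (sub 1 (tr_tm c f \<circ> e) Y)"
    using tracked_strong_instance[OF A(1) Y] A(3,4) by blast
  then have "reduced_source p B (inst 0 (Free a) (sub 1 (tr_tm c f \<circ> e) Y))"
    by (simp add: reduced_source_def)
  then show ?thesis using that(2,3) Y A(4) a(1) by auto
qed

text \<open>A tracked formula contains a strong quantifier, hence is compound; if that quantifier is
  not its head, \<open>skolem_first\<close> preserves the outermost symbol, so the result is no
  atom.\<close>

lemma reduced_source_atom:
  assumes "reduced_source p B G" and "is_atom B"
  shows "G = tr c f B"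
proof -
  have False if "tracked p n e A" "\<not> strong_headed p A" "B = sub 0 e (skolem_first p n f A)"
    for A n e
    using that assms(2) by (cases A) (auto simp: tracked_def split: if_splits)
  then show ?thesis using assms(1) by (auto simp: reduced_source_def)
qed

lemma reduced_source_Bot:
  assumes "reduced_source p Bot G"
  shows "G = Bot"
proof -
  have False if "tracked p n e A" "\<not> strong_headed p A" "Bot = sub 0 e (skolem_first p n f A)"
    for A n e
    using that by (cases A) (auto simp: tracked_def split: if_splits)
  then show ?thesis using assms by (auto simp: reduced_source_def)
qed

text \<open>A tracked formula without strong head keeps a head that is not strong. Strong inferences
  of the given derivation therefore act, after reduction, on plain formulas only.\<close>

lemma reduced_source_strong:
  assumes "reduced_source p B G" and "strong_headed p B"
  shows "skolem_closed f B \<and> G = tr c f B"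
proof -
  have False if "tracked p n e A" "\<not> strong_headed p A" "B = sub 0 e (skolem_first p n f A)"
    for A n e
    using that assms(2) by (cases A) (auto simp: tracked_def split: if_splits)
  then show ?thesis using assms(1) by (auto simp: reduced_source_def)
qed

text \<open>Tracking continues in the component where the search for the first strong quantifier
  continues; the other component becomes plain.\<close>

lemma reduced_source_And:
  assumes "reduced_source p (And B1 B2) G"
  shows "\<exists>G1 G2. G = And G1 G2 \<and> source p B1 G1 \<and> source p B2 G2"
  using assms unfolding reduced_source_def
proof (elim disjE exE conjE)
  fix A n e assume A: "tracked p n e A" "\<not> strong_headed p A"
    "And B1 B2 = sub 0 e (skolem_first p n f A)" "G = sub 0 (tr_tm c f \<circ> e) A"
  then obtain A1 A2 where A12: "A = And A1 A2"
    by (cases A) (auto simp: tracked_def split: if_splits)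
  show ?thesis
  proof (cases "has_strong p A1")
    case True
    then have "tracked p n e A1" using A(1) A12 by (simp add: tracked_def)
    then show ?thesis
      using A A12 True source_tracked[of p n e A1] source_untracked[of A2 e p]
      by (auto simp: tracked_def)
  next
    case False
    then have "tracked p n e A2" using A(1) A12 by (simp add: tracked_def)
    then show ?thesis
      using A A12 False source_tracked[of p n e A2] source_untracked[of A1 e p]
      by (auto simp: tracked_def)
  qed
qed (simp add: source_plain)

lemma reduced_source_Or:
  assumes "reduced_source p (Or B1 B2) G"
  shows "\<exists>G1 G2. G = Or G1 G2 \<and> source p B1 G1 \<and> source p B2 G2"
  using assms unfolding reduced_source_def
proof (elim disjE exE conjE)
  fix A n e assume A: "tracked p n e A" "\<not> strong_headed p A"
    "Or B1 B2 = sub 0 e (skolem_first p n f A)" "G = sub 0 (tr_tm c f \<circ> e) A"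
  then obtain A1 A2 where A12: "A = Or A1 A2"
    by (cases A) (auto simp: tracked_def split: if_splits)
  show ?thesis
  proof (cases "has_strong p A1")
    case True
    then have "tracked p n e A1" using A(1) A12 by (simp add: tracked_def)
    then show ?thesis
      using A A12 True source_tracked[of p n e A1] source_untracked[of A2 e p]
      by (auto simp: tracked_def)
  next
    case False
    then have "tracked p n e A2" using A(1) A12 by (simp add: tracked_def)
    then show ?thesis
      using A A12 False source_tracked[of p n e A2] source_untracked[of A1 e p]
      by (auto simp: tracked_def)
  qed
qed (simp add: source_plain)

lemma reduced_source_Imp:
  assumes "reduced_source p (Imp B1 B2) G"
  shows "\<exists>G1 G2. G = Imp G1 G2 \<and> source (\<not> p) B1 G1 \<and> source p B2 G2"
  using assms unfolding reduced_source_def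
proof (elim disjE exE conjE)
  fix A n e assume A: "tracked p n e A" "\<not> strong_headed p A"
    "Imp B1 B2 = sub 0 e (skolem_first p n f A)" "G = sub 0 (tr_tm c f \<circ> e) A"
  then obtain A1 A2 where A12: "A = Imp A1 A2"
    by (cases A) (auto simp: tracked_def split: if_splits)
  show ?thesis
  proof (cases "has_strong (\<not> p) A1")
    case True
    then have "tracked (\<not> p) n e A1" using A(1) A12 by (simp add: tracked_def)
    then show ?thesis
      using A A12 True source_tracked[of "\<not> p" n e A1] source_untracked[of A2 e p]
      by (auto simp: tracked_def)
  next
    case False
    then have "tracked p n e A2" using A(1) A12 by (simp add: tracked_def)
    then show ?thesis
      using A A12 False source_tracked[of p n e A2] source_untracked[of A1 e "\<not> p"]
      by (auto simp: tracked_def)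
  qed
qed (simp add: source_plain)

lemma source_instance:
  assumes "tracked p (Suc n) (case_nat t e) A" and "lc_tm 0 t" and "\<forall>i. lc_tm 0 (e i)"
  shows "source p (inst 0 t (sub 1 e (skolem_first p (Suc n) f A)))
    (inst 0 (tr_tm c f t) (sub 1 (tr_tm c f \<circ> e) A))"
  using source_tracked[OF assms(1)] assms(2,3)
  by (simp add: inst_sub lc_tm_tr_tm tr_comp_case_nat)

text \<open>A tracked formula stays tracked with \<open>t\<close> added to its environment. This is
  why the terms of weak inferences are confined to \<open>K\<close>.\<close>

lemma reduced_source_All:
  assumes "reduced_source False (All B) G" and t: "lc_tm 0 t" "funs_tm t \<subseteq> K"
  shows "\<exists>G'. G = All G' \<and> source False (inst 0 t B) (inst 0 (tr_tm c f t) G')"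
  using assms(1) unfolding reduced_source_def
proof (elim disjE exE conjE)
  assume "skolem_closed f (All B)" "G = tr c f (All B)"
  then show ?thesis
    using source_plain[of "inst 0 t B" False] t(1)
    by (simp add: skolem_closed_inst tr_inst)
next
  fix A n e assume A: "tracked False n e A" "\<not> strong_headed False A"
    "All B = sub 0 e (skolem_first False n f A)" "G = sub 0 (tr_tm c f \<circ> e) A"
  then obtain A' where A': "A = All A'"
    by (cases A) (auto simp: tracked_def split: if_splits)
  have "tracked False (Suc n) (case_nat t e) A'"
    using A(1) A' t by (auto simp: tracked_def split: nat.split)
  then show ?thesis
    using source_instance[of False n t e A'] A A' t by (auto simp: tracked_def)
qed

lemma reduced_source_Ex:
  assumes "reduced_source True (Ex B) G" and t: "lc_tm 0 t" "funs_tm t \<subseteq> K"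
  shows "\<exists>G'. G = Ex G' \<and> source True (inst 0 t B) (inst 0 (tr_tm c f t) G')"
  using assms(1) unfolding reduced_source_def
proof (elim disjE exE conjE)
  assume "skolem_closed f (Ex B)" "G = tr c f (Ex B)"
  then show ?thesis
    using source_plain[of "inst 0 t B" True] t(1)
    by (simp add: skolem_closed_inst tr_inst)
next
  fix A n e assume A: "tracked True n e A" "\<not> strong_headed True A"
    "Ex B = sub 0 e (skolem_first True n f A)" "G = sub 0 (tr_tm c f \<circ> e) A"
  then obtain A' where A': "A = Ex A'"
    by (cases A) (auto simp: tracked_def split: if_splits)
  have "tracked True (Suc n) (case_nat t e) A'"
    using A(1) A' t by (auto simp: tracked_def split: nat.split)
  then show ?thesis
    using source_instance[of True n t e A'] A A' t by (auto simp: tracked_def)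
qed

lemma lc_rel_mset_source:
  "rel_mset (source p) M N \<Longrightarrow> \<forall>B\<in>#M. lc 0 B \<Longrightarrow> \<forall>G\<in>#N. lc 0 G"
proof (induction M arbitrary: N)
  case (add B M)
  then show ?case by (auto dest!: msed_rel_invL intro: lc_source)
qed simp

lemma lj_sequent_source:
  assumes "lj_sequent (\<Gamma> \<turnstile> \<Delta>)" "rel_mset (source False) \<Gamma> \<Gamma>'" "rel_mset (source True) \<Delta> \<Delta>'"
  shows "lj_sequent (\<Gamma>' \<turnstile> \<Delta>')"
  using assms lc_rel_mset_source[OF assms(2)] lc_rel_mset_source[OF assms(3)]
    rel_mset_size[OF assms(3)]
  by (auto simp: lj_sequent_def)

section \<open>Translating the derivation\<close>

lemma derivable_principal_antecedent:
  assumes "rel_mset (source False) (add_mset B \<Gamma>) \<Gamma>'" and "rel_mset (source True) \<Delta> \<Delta>'"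
    and "lj_sequent (add_mset B \<Gamma> \<turnstile> \<Delta>)"
    and step: "\<And>G \<Gamma>0. rel_mset (source False) \<Gamma> \<Gamma>0 \<Longrightarrow> reduced_source False B G \<Longrightarrow>
      lj_sequent (add_mset G \<Gamma>0 \<turnstile> \<Delta>') \<Longrightarrow> derivable_within new_strong K (add_mset G \<Gamma>0 \<turnstile> \<Delta>')"
  shows "derivable_within new_strong K (\<Gamma>' \<turnstile> \<Delta>')"
proof -
  obtain G \<Gamma>0 where G: "\<Gamma>' = add_mset G \<Gamma>0" "source False B G" "rel_mset (source False) \<Gamma> \<Gamma>0"
    using msed_rel_invL[OF assms(1)] by blast
  have ok: "lj_sequent (add_mset H \<Gamma>0 \<turnstile> \<Delta>')" if "source False B H" for H
    using lj_sequent_source assms(2,3) rel_mset_Plus[OF that G(3)] by blast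
  from G(2) show ?thesis
  proof (cases rule: source_cases)
    case 1
    then show ?thesis using step G ok source_of_reduced by blast
  next
    case 2
    then show ?thesis by simp
  next
    case (3 a Y)
    then have "derivable_within new_strong K (add_mset (inst 0 (Free a) Y) \<Gamma>0 \<turnstile> \<Delta>')"
      using step G(3) ok source_of_reduced by blast
    then show ?thesis
      \<comment> \<open>The inference on \<open>B\<close> has been carried out on the instance; the
        restoring \<open>ExL\<close> goes directly below it. It only has to belong to
        \<open>new_strong\<close>, whatever else of the context contains \<open>a\<close>.\<close>
      using derivable_withinI[OF lk_inference.intros(17)[of Y a \<Gamma>0 \<Delta>']] 3 ok[OF G(2)] G(1) by simp
  qed
qed

lemma derivable_principal_succedent:
  assumes "rel_mset (source False) \<Gamma> \<Gamma>'" and "rel_mset (source True) (add_mset B \<Delta>) \<Delta>'"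
    and "lj_sequent (\<Gamma> \<turnstile> add_mset B \<Delta>)"
    and step: "\<And>G \<Delta>0. rel_mset (source True) \<Delta> \<Delta>0 \<Longrightarrow> reduced_source True B G \<Longrightarrow>
      lj_sequent (\<Gamma>' \<turnstile> add_mset G \<Delta>0) \<Longrightarrow> derivable_within new_strong K (\<Gamma>' \<turnstile> add_mset G \<Delta>0)"
  shows "derivable_within new_strong K (\<Gamma>' \<turnstile> \<Delta>')"
proof -
  obtain G \<Delta>0 where G: "\<Delta>' = add_mset G \<Delta>0" "source True B G" "rel_mset (source True) \<Delta> \<Delta>0"
    using msed_rel_invL[OF assms(2)] by blast
  have ok: "lj_sequent (\<Gamma>' \<turnstile> add_mset H \<Delta>0)" if "source True B H" for H
    using lj_sequent_source assms(1,3) rel_mset_Plus[OF that G(3)] by blast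
  from G(2) show ?thesis
  proof (cases rule: source_cases)
    case 1
    then show ?thesis using step G ok source_of_reduced by blast
  next
    case (2 a Y)
    then have "derivable_within new_strong K (\<Gamma>' \<turnstile> add_mset (inst 0 (Free a) Y) \<Delta>0)"
      using step G(3) ok source_of_reduced by blast
    then show ?thesis
      using derivable_withinI[OF lk_inference.intros(16)[of Y a \<Gamma>' \<Delta>0]] 2 ok[OF G(2)] G(1) by simp
  next
    case 3
    then show ?thesis by simp
  qed
qed

text \<open>Replacements are passed from conclusions to premises: an occurrence inherits the choice
  made for its descendant below. Hence the claim must hold for every choice of
  \<open>\<Gamma>'\<close> and \<open>\<Delta>'\<close>.\<close>

lemma derivable_source:
  assumes "derivable_within \<Sigma> K S"
    and "rel_mset (source False) (antecedent S) \<Gamma>'" and "rel_mset (source True) (succedent S) \<Delta>'"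
  shows "derivable_within new_strong K (\<Gamma>' \<turnstile> \<Delta>')"
  using assms
proof (induction arbitrary: \<Gamma>' \<Delta>' rule: derivable_within.induct)
  case (derivable_withinI r Ss S)
  note allowed = derivable_withinI.hyps(2)
  note lj = derivable_withinI.hyps(3)
  note rel = derivable_withinI.prems
  have IH: "derivable_within new_strong K (\<Gamma>0 \<turnstile> \<Delta>0)"
    if "(\<Gamma> \<turnstile> \<Delta>) \<in> set Ss" "rel_mset (source False) \<Gamma> \<Gamma>0" "rel_mset (source True) \<Delta> \<Delta>0"
    for \<Gamma> \<Delta> \<Gamma>0 \<Delta>0
    using derivable_withinI.IH[OF that(1)] that(2,3) by simp
  have empty: "N = {#}" if "rel_mset (source p) {#} N" for p N
    using rel_mset_size[OF that] by simp
  note add = rel_mset_Plus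
  note infer = derivable_within.intros
  have lj': "lj_sequent (\<Gamma>' \<turnstile> \<Delta>')"
    using lj lj_sequent_source rel by (cases S) auto
  from derivable_withinI.hyps(1) show ?case
  proof (cases rule: lk_inference.cases)
    case (1 A)
    show ?thesis
    \<comment> \<open>Both occurrences of an axiom are principal, so quantifiers are restored on
      each side separately; what remains on both sides is the same atom
      \<open>tr c f A\<close>.\<close>
    proof (rule derivable_principal_antecedent)
      show "rel_mset (source False) (add_mset A {#}) \<Gamma>'" "rel_mset (source True) {#A#} \<Delta>'"
        "lj_sequent ({#A#} \<turnstile> {#A#})"
        using rel lj 1 by simp_all
      fix G \<Gamma>0 assume G: "rel_mset (source False) {#} \<Gamma>0" "reduced_source False A G"
      show "derivable_within new_strong K (add_mset G \<Gamma>0 \<turnstile> \<Delta>')"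
      proof (rule derivable_principal_succedent)
        show "rel_mset (source False) {#A#} (add_mset G \<Gamma>0)"
          by (rule add[OF source_of_reduced[OF G(2)] G(1)])
        show "rel_mset (source True) (add_mset A {#}) \<Delta>'" "lj_sequent ({#A#} \<turnstile> {#A#})"
          using rel lj 1 by simp_all
        fix H \<Delta>0 assume H: "rel_mset (source True) {#} \<Delta>0" "reduced_source True A H"
          "lj_sequent (add_mset G \<Gamma>0 \<turnstile> add_mset H \<Delta>0)"
        have "G = tr c f A" "H = tr c f A"
          using reduced_source_atom[OF G(2)] reduced_source_atom[OF H(2)] 1 by simp_all
        moreover have "is_atom (tr c f A)" using 1 by (cases A) auto
        moreover have "\<Gamma>0 = {#}" "\<Delta>0 = {#}"
          using empty[OF G(1)] empty[OF H(1)] by simp_all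
        ultimately show "derivable_within new_strong K (add_mset G \<Gamma>0 \<turnstile> add_mset H \<Delta>0)"
          using infer[OF lk_inference.intros(1)[of G]] H(3) by simp
      qed
    qed
  next
    case 2
    show ?thesis
    proof (rule derivable_principal_antecedent)
      show "rel_mset (source False) (add_mset Bot {#}) \<Gamma>'" "rel_mset (source True) {#} \<Delta>'"
        "lj_sequent ({#Bot :: ('f, 'p) fm#} \<turnstile> {#})"
        using rel lj 2 by simp_all
      fix G \<Gamma>0 assume G: "rel_mset (source False) {#} \<Gamma>0" "reduced_source False Bot G"
        "lj_sequent (add_mset G \<Gamma>0 \<turnstile> \<Delta>')"
      have "rel_mset (source True) {#} \<Delta>'" using rel 2 by simp
      then have "\<Gamma>0 = {#}" "\<Delta>' = {#}"
        using empty G(1) by blast+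
      then show "derivable_within new_strong K (add_mset G \<Gamma>0 \<turnstile> \<Delta>')"
        using infer[OF lk_inference.intros(2)] reduced_source_Bot[OF G(2)] G(3) by simp
    qed
  next
    \<comment> \<open>The replacement is weakened in as a whole, so no quantifier is
      restored.\<close>
    case (3 \<Gamma> \<Delta> A)
    then obtain G \<Gamma>0 where G: "\<Gamma>' = add_mset G \<Gamma>0" "rel_mset (source False) \<Gamma> \<Gamma>0"
      using msed_rel_invL[of "source False" A \<Gamma> \<Gamma>'] rel(1) by auto
    then have "derivable_within new_strong K (\<Gamma>0 \<turnstile> \<Delta>')"
      using IH[of \<Gamma> \<Delta>] rel 3 by simp
    then show ?thesis
      using infer[OF lk_inference.intros(3)[of \<Gamma>0 \<Delta>' G]] lj' G(1) by simp
  next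
    case (4 \<Gamma> \<Delta> A)
    then obtain G \<Delta>0 where G: "\<Delta>' = add_mset G \<Delta>0" "rel_mset (source True) \<Delta> \<Delta>0"
      using msed_rel_invL[of "source True" A \<Delta> \<Delta>'] rel(2) by auto
    then have "derivable_within new_strong K (\<Gamma>' \<turnstile> \<Delta>0)"
      using IH[of \<Gamma> \<Delta>] rel 4 by simp
    then show ?thesis
      using infer[OF lk_inference.intros(4)[of \<Gamma>' \<Delta>0 G]] lj' G(1) by simp
  next
    \<comment> \<open>Both copies in the premise inherit the same \<open>G\<close> and can be
      contracted again.\<close>
    case (5 A \<Gamma> \<Delta>)
    then obtain G \<Gamma>0 where G: "\<Gamma>' = add_mset G \<Gamma>0" "source False A G"
        "rel_mset (source False) \<Gamma> \<Gamma>0"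
      using msed_rel_invL[of "source False" A \<Gamma> \<Gamma>'] rel(1) by auto
    then have "derivable_within new_strong K (add_mset G (add_mset G \<Gamma>0) \<turnstile> \<Delta>')"
      using IH[of "add_mset A (add_mset A \<Gamma>)" \<Delta>] rel 5 add[OF G(2) add[OF G(2,3)]] by simp
    then show ?thesis
      using infer[OF lk_inference.intros(5)[of G \<Gamma>0 \<Delta>']] lj' G(1) by simp
  next
    case (6 \<Gamma> A \<Delta>)
    then obtain G \<Delta>0 where G: "\<Delta>' = add_mset G \<Delta>0" "source True A G"
        "rel_mset (source True) \<Delta> \<Delta>0"
      using msed_rel_invL[of "source True" A \<Delta> \<Delta>'] rel(2) by auto
    then have "derivable_within new_strong K (\<Gamma>' \<turnstile> add_mset G (add_mset G \<Delta>0))"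
      using IH[of \<Gamma> "add_mset A (add_mset A \<Delta>)"] rel 6 add[OF G(2) add[OF G(2,3)]] by simp
    then show ?thesis
      using infer[OF lk_inference.intros(6)[of \<Gamma>' G \<Delta>0]] lj' G(1) by simp
  next
    case (7 A \<Gamma> \<Delta> B)
    show ?thesis
    proof (rule derivable_principal_antecedent)
      show "rel_mset (source False) (add_mset (And A B) \<Gamma>) \<Gamma>'" "rel_mset (source True) \<Delta> \<Delta>'"
        "lj_sequent (add_mset (And A B) \<Gamma> \<turnstile> \<Delta>)"
        using rel lj 7 by simp_all
      fix G \<Gamma>0 assume G: "rel_mset (source False) \<Gamma> \<Gamma>0" "reduced_source False (And A B) G"
        "lj_sequent (add_mset G \<Gamma>0 \<turnstile> \<Delta>')"
      obtain G1 G2 where GG: "G = And G1 G2" "source False A G1"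
        using reduced_source_And[OF G(2)] by blast
      then have "derivable_within new_strong K (add_mset G1 \<Gamma>0 \<turnstile> \<Delta>')"
        using IH[of "add_mset A \<Gamma>" \<Delta>] rel 7 add[OF GG(2) G(1)] by simp
      then show "derivable_within new_strong K (add_mset G \<Gamma>0 \<turnstile> \<Delta>')"
        using infer[OF lk_inference.intros(7)[of G1 \<Gamma>0 \<Delta>' G2]] GG(1) G(3) by simp
    qed
  next
    case (8 B \<Gamma> \<Delta> A)
    show ?thesis
    proof (rule derivable_principal_antecedent)
      show "rel_mset (source False) (add_mset (And A B) \<Gamma>) \<Gamma>'" "rel_mset (source True) \<Delta> \<Delta>'"
        "lj_sequent (add_mset (And A B) \<Gamma> \<turnstile> \<Delta>)"
        using rel lj 8 by simp_all
      fix G \<Gamma>0 assume G: "rel_mset (source False) \<Gamma> \<Gamma>0" "reduced_source False (And A B) G"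
        "lj_sequent (add_mset G \<Gamma>0 \<turnstile> \<Delta>')"
      obtain G1 G2 where GG: "G = And G1 G2" "source False B G2"
        using reduced_source_And[OF G(2)] by blast
      then have "derivable_within new_strong K (add_mset G2 \<Gamma>0 \<turnstile> \<Delta>')"
        using IH[of "add_mset B \<Gamma>" \<Delta>] rel 8 add[OF GG(2) G(1)] by simp
      then show "derivable_within new_strong K (add_mset G \<Gamma>0 \<turnstile> \<Delta>')"
        using infer[OF lk_inference.intros(8)[of G2 \<Gamma>0 \<Delta>' G1]] GG(1) G(3) by simp
    qed
  next
    case (9 \<Gamma> A \<Delta> B)
    show ?thesis
    proof (rule derivable_principal_succedent)
      show "rel_mset (source False) \<Gamma> \<Gamma>'" "rel_mset (source True) (add_mset (And A B) \<Delta>) \<Delta>'"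
        "lj_sequent (\<Gamma> \<turnstile> add_mset (And A B) \<Delta>)"
        using rel lj 9 by simp_all
      fix G \<Delta>0 assume G: "rel_mset (source True) \<Delta> \<Delta>0" "reduced_source True (And A B) G"
        "lj_sequent (\<Gamma>' \<turnstile> add_mset G \<Delta>0)"
      obtain G1 G2 where GG: "G = And G1 G2" "source True A G1" "source True B G2"
        using reduced_source_And[OF G(2)] by blast
      have "derivable_within new_strong K (\<Gamma>' \<turnstile> add_mset G1 \<Delta>0)"
        using IH[of \<Gamma> "add_mset A \<Delta>"] rel 9 add[OF GG(2) G(1)] by simp
      moreover have "derivable_within new_strong K (\<Gamma>' \<turnstile> add_mset G2 \<Delta>0)"
        using IH[of \<Gamma> "add_mset B \<Delta>"] rel 9 add[OF GG(3) G(1)] by simp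
      ultimately show "derivable_within new_strong K (\<Gamma>' \<turnstile> add_mset G \<Delta>0)"
        using infer[OF lk_inference.intros(9)[of \<Gamma>' G1 \<Delta>0 G2]] GG(1) G(3) by auto
    qed
  next
    case (10 A \<Gamma> \<Delta> B)
    show ?thesis
    proof (rule derivable_principal_antecedent)
      show "rel_mset (source False) (add_mset (Or A B) \<Gamma>) \<Gamma>'" "rel_mset (source True) \<Delta> \<Delta>'"
        "lj_sequent (add_mset (Or A B) \<Gamma> \<turnstile> \<Delta>)"
        using rel lj 10 by simp_all
      fix G \<Gamma>0 assume G: "rel_mset (source False) \<Gamma> \<Gamma>0" "reduced_source False (Or A B) G"
        "lj_sequent (add_mset G \<Gamma>0 \<turnstile> \<Delta>')"
      obtain G1 G2 where GG: "G = Or G1 G2" "source False A G1" "source False B G2"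
        using reduced_source_Or[OF G(2)] by blast
      have "derivable_within new_strong K (add_mset G1 \<Gamma>0 \<turnstile> \<Delta>')"
        using IH[of "add_mset A \<Gamma>" \<Delta>] rel 10 add[OF GG(2) G(1)] by simp
      moreover have "derivable_within new_strong K (add_mset G2 \<Gamma>0 \<turnstile> \<Delta>')"
        using IH[of "add_mset B \<Gamma>" \<Delta>] rel 10 add[OF GG(3) G(1)] by simp
      ultimately show "derivable_within new_strong K (add_mset G \<Gamma>0 \<turnstile> \<Delta>')"
        using infer[OF lk_inference.intros(10)[of G1 \<Gamma>0 \<Delta>' G2]] GG(1) G(3) by auto
    qed
  next
    case (11 \<Gamma> A \<Delta> B)
    show ?thesis
    proof (rule derivable_principal_succedent)
      show "rel_mset (source False) \<Gamma> \<Gamma>'" "rel_mset (source True) (add_mset (Or A B) \<Delta>) \<Delta>'"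
        "lj_sequent (\<Gamma> \<turnstile> add_mset (Or A B) \<Delta>)"
        using rel lj 11 by simp_all
      fix G \<Delta>0 assume G: "rel_mset (source True) \<Delta> \<Delta>0" "reduced_source True (Or A B) G"
        "lj_sequent (\<Gamma>' \<turnstile> add_mset G \<Delta>0)"
      obtain G1 G2 where GG: "G = Or G1 G2" "source True A G1"
        using reduced_source_Or[OF G(2)] by blast
      then have "derivable_within new_strong K (\<Gamma>' \<turnstile> add_mset G1 \<Delta>0)"
        using IH[of \<Gamma> "add_mset A \<Delta>"] rel 11 add[OF GG(2) G(1)] by simp
      then show "derivable_within new_strong K (\<Gamma>' \<turnstile> add_mset G \<Delta>0)"
        using infer[OF lk_inference.intros(11)[of \<Gamma>' G1 \<Delta>0 G2]] GG(1) G(3) by simp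
    qed
  next
    case (12 \<Gamma> B \<Delta> A)
    show ?thesis
    proof (rule derivable_principal_succedent)
      show "rel_mset (source False) \<Gamma> \<Gamma>'" "rel_mset (source True) (add_mset (Or A B) \<Delta>) \<Delta>'"
        "lj_sequent (\<Gamma> \<turnstile> add_mset (Or A B) \<Delta>)"
        using rel lj 12 by simp_all
      fix G \<Delta>0 assume G: "rel_mset (source True) \<Delta> \<Delta>0" "reduced_source True (Or A B) G"
        "lj_sequent (\<Gamma>' \<turnstile> add_mset G \<Delta>0)"
      obtain G1 G2 where GG: "G = Or G1 G2" "source True B G2"
        using reduced_source_Or[OF G(2)] by blast
      then have "derivable_within new_strong K (\<Gamma>' \<turnstile> add_mset G2 \<Delta>0)"
        using IH[of \<Gamma> "add_mset B \<Delta>"] rel 12 add[OF GG(2) G(1)] by simp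
      then show "derivable_within new_strong K (\<Gamma>' \<turnstile> add_mset G \<Delta>0)"
        using infer[OF lk_inference.intros(12)[of \<Gamma>' G2 \<Delta>0 G1]] GG(1) G(3) by simp
    qed
  next
    case (13 \<Gamma> A \<Delta> B \<Pi> \<Lambda>)
    show ?thesis
    proof (rule derivable_principal_antecedent)
      show "rel_mset (source False) (add_mset (Imp A B) (\<Gamma> + \<Pi>)) \<Gamma>'"
        "rel_mset (source True) (\<Delta> + \<Lambda>) \<Delta>'"
        "lj_sequent (add_mset (Imp A B) (\<Gamma> + \<Pi>) \<turnstile> \<Delta> + \<Lambda>)"
        using rel lj 13 by simp_all
      then obtain \<Delta>1 \<Delta>2 where \<Delta>: "\<Delta>' = \<Delta>1 + \<Delta>2" "rel_mset (source True) \<Delta> \<Delta>1"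
          "rel_mset (source True) \<Lambda> \<Delta>2"
        using rel_mset_union_split by blast
      fix G \<Gamma>0 assume G: "rel_mset (source False) (\<Gamma> + \<Pi>) \<Gamma>0"
        "reduced_source False (Imp A B) G" "lj_sequent (add_mset G \<Gamma>0 \<turnstile> \<Delta>')"
      obtain \<Gamma>1 \<Gamma>2 where \<Gamma>: "\<Gamma>0 = \<Gamma>1 + \<Gamma>2" "rel_mset (source False) \<Gamma> \<Gamma>1"
          "rel_mset (source False) \<Pi> \<Gamma>2"
        using rel_mset_union_split G(1) by blast
      obtain G1 G2 where GG: "G = Imp G1 G2" "source True A G1" "source False B G2"
        using reduced_source_Imp[OF G(2)] by auto
      have "derivable_within new_strong K (\<Gamma>1 \<turnstile> add_mset G1 \<Delta>1)"
        using IH[of \<Gamma> "add_mset A \<Delta>"] 13 \<Gamma>(2) add[OF GG(2) \<Delta>(2)] by simp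
      moreover have "derivable_within new_strong K (add_mset G2 \<Gamma>2 \<turnstile> \<Delta>2)"
        using IH[of "add_mset B \<Pi>" \<Lambda>] 13 \<Delta>(3) add[OF GG(3) \<Gamma>(3)] by simp
      ultimately show "derivable_within new_strong K (add_mset G \<Gamma>0 \<turnstile> \<Delta>')"
        using infer[OF lk_inference.intros(13)[of \<Gamma>1 G1 \<Delta>1 G2 \<Gamma>2 \<Delta>2]] GG(1) G(3) \<Gamma>(1) \<Delta>(1)
        by auto
    qed
  next
    case (14 A \<Gamma> B \<Delta>)
    show ?thesis
    proof (rule derivable_principal_succedent)
      show "rel_mset (source False) \<Gamma> \<Gamma>'" "rel_mset (source True) (add_mset (Imp A B) \<Delta>) \<Delta>'"
        "lj_sequent (\<Gamma> \<turnstile> add_mset (Imp A B) \<Delta>)"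
        using rel lj 14 by simp_all
      fix G \<Delta>0 assume G: "rel_mset (source True) \<Delta> \<Delta>0" "reduced_source True (Imp A B) G"
        "lj_sequent (\<Gamma>' \<turnstile> add_mset G \<Delta>0)"
      obtain G1 G2 where GG: "G = Imp G1 G2" "source False A G1" "source True B G2"
        using reduced_source_Imp[OF G(2)] by auto
      have "rel_mset (source False) (add_mset A \<Gamma>) (add_mset G1 \<Gamma>')"
        using rel 14 add[where R = "source False", OF GG(2)] by simp
      then have "derivable_within new_strong K (add_mset G1 \<Gamma>' \<turnstile> add_mset G2 \<Delta>0)"
        using IH[of "add_mset A \<Gamma>" "add_mset B \<Delta>"] 14 add[OF GG(3) G(1)] by simp
      then show "derivable_within new_strong K (\<Gamma>' \<turnstile> add_mset G \<Delta>0)"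
        using infer[OF lk_inference.intros(14)[of G1 \<Gamma>' G2 \<Delta>0]] GG(1) G(3) by simp
    qed
  next
    case (15 t A \<Gamma> \<Delta>)
    show ?thesis
    proof (rule derivable_principal_antecedent)
      show "rel_mset (source False) (add_mset (All A) \<Gamma>) \<Gamma>'" "rel_mset (source True) \<Delta> \<Delta>'"
        "lj_sequent (add_mset (All A) \<Gamma> \<turnstile> \<Delta>)"
        using rel lj 15 by simp_all
      fix G \<Gamma>0 assume G: "rel_mset (source False) \<Gamma> \<Gamma>0" "reduced_source False (All A) G"
        "lj_sequent (add_mset G \<Gamma>0 \<turnstile> \<Delta>')"
      have t: "lc_tm 0 t" "funs_tm t \<subseteq> K" using 15 allowed by auto
      \<comment> \<open>The term \<open>t\<close> may itself contain Skolem terms, so the new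
        inference uses its translation.\<close>
      then have t': "lc_tm 0 (tr_tm c f t)" "funs_tm (tr_tm c f t) \<subseteq> K"
        using lc_tm_tr_tm funs_tm_tr_tm by fast+
      obtain G' where GG: "G = All G'" "source False (inst 0 t A) (inst 0 (tr_tm c f t) G')"
        using reduced_source_All[OF G(2) t] by blast
      have "derivable_within new_strong K (add_mset (inst 0 (tr_tm c f t) G') \<Gamma>0 \<turnstile> \<Delta>')"
        using IH[of "add_mset (inst 0 t A) \<Gamma>" \<Delta>] rel 15 add[OF GG(2) G(1)] by simp
      then show "derivable_within new_strong K (add_mset G \<Gamma>0 \<turnstile> \<Delta>')"
        using infer[OF lk_inference.intros(15)[of "tr_tm c f t" G' \<Gamma>0 \<Delta>']] GG(1) G(3) t' by simp
    qed
  next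
    case (16 A a \<Gamma> \<Delta>)
    show ?thesis
    proof (rule derivable_principal_succedent)
      show "rel_mset (source False) \<Gamma> \<Gamma>'" "rel_mset (source True) (add_mset (All A) \<Delta>) \<Delta>'"
        "lj_sequent (\<Gamma> \<turnstile> add_mset (All A) \<Delta>)"
        using rel lj 16 by simp_all
      fix G \<Delta>0 assume G: "rel_mset (source True) \<Delta> \<Delta>0" "reduced_source True (All A) G"
        "lj_sequent (\<Gamma>' \<turnstile> add_mset G \<Delta>0)"
      have GG: "skolem_closed f A" "G = All (tr c f A)"
        using reduced_source_strong[OF G(2)] by auto
      then have src: "source True (inst 0 (Free a) A) (inst 0 (Free (2 * a)) (tr c f A))"
        using source_plain[of "inst 0 (Free a) A" True] by (simp add: skolem_closed_inst tr_inst)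
      have "derivable_within new_strong K (\<Gamma>' \<turnstile> add_mset (inst 0 (Free (2 * a)) (tr c f A)) \<Delta>0)"
        using IH[of \<Gamma> "add_mset (inst 0 (Free a) A) \<Delta>"] rel 16 add[OF src G(1)] by simp
      moreover have "(2 * a, All (tr c f A)) \<in> new_strong"
        using allowed 16 unfolding new_strong_def by force
      ultimately show "derivable_within new_strong K (\<Gamma>' \<turnstile> add_mset G \<Delta>0)"
        using infer[OF lk_inference.intros(16)[of "tr c f A" "2 * a" \<Gamma>' \<Delta>0]] GG(2) G(3) by simp
    qed
  next
    case (17 A a \<Gamma> \<Delta>)
    show ?thesis
    proof (rule derivable_principal_antecedent)
      show "rel_mset (source False) (add_mset (Ex A) \<Gamma>) \<Gamma>'" "rel_mset (source True) \<Delta> \<Delta>'"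
        "lj_sequent (add_mset (Ex A) \<Gamma> \<turnstile> \<Delta>)"
        using rel lj 17 by simp_all
      fix G \<Gamma>0 assume G: "rel_mset (source False) \<Gamma> \<Gamma>0" "reduced_source False (Ex A) G"
        "lj_sequent (add_mset G \<Gamma>0 \<turnstile> \<Delta>')"
      have GG: "skolem_closed f A" "G = Ex (tr c f A)"
        using reduced_source_strong[OF G(2)] by auto
      then have src: "source False (inst 0 (Free a) A) (inst 0 (Free (2 * a)) (tr c f A))"
        using source_plain[of "inst 0 (Free a) A" False] by (simp add: skolem_closed_inst tr_inst)
      have "derivable_within new_strong K (add_mset (inst 0 (Free (2 * a)) (tr c f A)) \<Gamma>0 \<turnstile> \<Delta>')"
        using IH[of "add_mset (inst 0 (Free a) A) \<Gamma>" \<Delta>] rel 17 add[OF src G(1)] by simp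
      moreover have "(2 * a, Ex (tr c f A)) \<in> new_strong"
        using allowed 17 unfolding new_strong_def by force
      ultimately show "derivable_within new_strong K (add_mset G \<Gamma>0 \<turnstile> \<Delta>')"
        using infer[OF lk_inference.intros(17)[of "tr c f A" "2 * a" \<Gamma>0 \<Delta>']] GG(2) G(3) by simp
    qed
  next
    case (18 t A \<Gamma> \<Delta>)
    show ?thesis
    proof (rule derivable_principal_succedent)
      show "rel_mset (source False) \<Gamma> \<Gamma>'" "rel_mset (source True) (add_mset (Ex A) \<Delta>) \<Delta>'"
        "lj_sequent (\<Gamma> \<turnstile> add_mset (Ex A) \<Delta>)"
        using rel lj 18 by simp_all
      fix G \<Delta>0 assume G: "rel_mset (source True) \<Delta> \<Delta>0" "reduced_source True (Ex A) G"
        "lj_sequent (\<Gamma>' \<turnstile> add_mset G \<Delta>0)"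
      have t: "lc_tm 0 t" "funs_tm t \<subseteq> K" using 18 allowed by auto
      then have t': "lc_tm 0 (tr_tm c f t)" "funs_tm (tr_tm c f t) \<subseteq> K"
        using lc_tm_tr_tm funs_tm_tr_tm by fast+
      obtain G' where GG: "G = Ex G'" "source True (inst 0 t A) (inst 0 (tr_tm c f t) G')"
        using reduced_source_Ex[OF G(2) t] by blast
      have "derivable_within new_strong K (\<Gamma>' \<turnstile> add_mset (inst 0 (tr_tm c f t) G') \<Delta>0)"
        using IH[of \<Gamma> "add_mset (inst 0 t A) \<Delta>"] rel 18 add[OF GG(2) G(1)] by simp
      then show "derivable_within new_strong K (\<Gamma>' \<turnstile> add_mset G \<Delta>0)"
        using infer[OF lk_inference.intros(18)[of "tr_tm c f t" G' \<Gamma>' \<Delta>0]] GG(1) G(3) t' by simp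
    qed
  next
    case (19 \<Gamma> A \<Delta> \<Pi> \<Lambda>)
    then show ?thesis using allowed by simp
  qed
qed

end

text \<open>Allowing \<open>B = A\<close> gives one relation for the changed formula and its
  unchanged neighbours, so that it lifts to multisets.\<close>

definition skolem_step :: "'f \<Rightarrow> ('f, 'p) fm \<Rightarrow> bool \<Rightarrow> ('f, 'p) fm \<Rightarrow> ('f, 'p) fm \<Rightarrow> bool" where
  "skolem_step f Q p B A \<longleftrightarrow> closed_fm A \<and> f \<notin> funs A \<and>
    (B = A \<or> has_strong p A \<and> first_strong p A = Q \<and> B = skolem_first p 0 f A)"

lemma (in skolem_elimination) source_of_skolem_step:
  assumes "skolem_step f Q p B A"
  shows "source p B A"
proof (cases "B = A")
  case True
  have A: "lc 0 A" "fv A = {}" "f \<notin> funs A"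
    using assms by (auto simp: skolem_step_def closed_fm_def)
  then have "skolem_closed f A"
    using skolem_closed_sub[of f A "\<lambda>i. Free i" 0] by (simp add: sub_lc)
  then show ?thesis using source_plain[of A p] tr_id[of A f c] A True by simp
next
  case False
  \<comment> \<open>At \<open>n = 0\<close> no value of the environment is used; \<open>Free\<close>
    serves as a default without dangling indices or function symbols.\<close>
  then have "tracked p 0 (\<lambda>i. Free i) A" and B: "B = skolem_first p 0 f A" and A: "lc 0 A"
    using assms by (auto simp: skolem_step_def closed_fm_def tracked_def)
  then show ?thesis
    using source_tracked[of p 0 "\<lambda>i. Free i" A] by (simp add: sub_lc lc_skolem_first)
qed

lemma suitably_derivable_skolem_step:
  fixes \<Gamma> \<Delta> \<Gamma>' \<Delta>' :: "('f, 'p) fm multiset"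
  assumes "suitably_derivable (\<Gamma> \<turnstile> \<Delta>)" and "fv Q = {}"
    and "rel_mset (skolem_step f Q False) \<Gamma> \<Gamma>'" and "rel_mset (skolem_step f Q True) \<Delta> \<Delta>'"
  shows "suitably_derivable (\<Gamma>' \<turnstile> \<Delta>')"
proof -
  obtain \<Sigma> K where \<Sigma>: "finite K" "\<forall>(a, P)\<in>\<Sigma>. funs P \<subseteq> K" "suitable_set \<Sigma>"
      "derivable_within \<Sigma> K (\<Gamma> \<turnstile> \<Delta>)"
    using assms(1) unfolding suitably_derivable_def by blast
  \<comment> \<open>\<open>K\<close> comes from the quantifier inferences, so it may miss
    \<open>f\<close> and symbols of \<open>Q\<close>.\<close>
  let ?K = "insert f (K \<union> funs Q)"
  obtain c :: "'f tm \<Rightarrow> nat" where c: "inj_on c {t. funs_tm t \<subseteq> ?K}" "\<forall>h ts. \<forall>u\<in>set ts. c u < c (Fun h ts)"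
    using ex_term_code[of ?K] \<Sigma>(1) by auto
  interpret skolem_elimination c f ?K Q \<Sigma>
    using c \<Sigma>(2,3) assms(2) by unfold_locales auto
  have "rel_mset (source False) \<Gamma> \<Gamma>'" "rel_mset (source True) \<Delta> \<Delta>'"
    using assms(3,4) source_of_skolem_step multiset.rel_mono_strong by blast+
  then have "derivable_within new_strong ?K (\<Gamma>' \<turnstile> \<Delta>')"
    using derivable_source[of "\<Gamma> \<turnstile> \<Delta>" \<Gamma>' \<Delta>'] derivable_within_mono[OF \<Sigma>(4), of \<Sigma> ?K] by auto
  then show ?thesis
    using suitable_new_strong funs_new_strong \<Sigma>(1) unfolding suitably_derivable_def
    by (intro exI[of _ new_strong] exI[of _ ?K]) auto
qed

section \<open>Skolemization of sequents\<close>

lemma lc_Conj: "lc k (Conj As) \<longleftrightarrow> (\<forall>A\<in>set As. lc k A)"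
  by (induction As rule: Conj.induct) auto

lemma lc_Disj: "lc k (Disj As) \<longleftrightarrow> (\<forall>A\<in>set As. lc k A)"
  by (induction As rule: Disj.induct) auto

lemma fv_Conj: "fv (Conj As) = (\<Union>A\<in>set As. fv A)"
  by (induction As rule: Conj.induct) auto

lemma fv_Disj: "fv (Disj As) = (\<Union>A\<in>set As. fv A)"
  by (induction As rule: Disj.induct) auto

lemma funs_Conj: "funs (Conj As) = (\<Union>A\<in>set As. funs A)"
  by (induction As rule: Conj.induct) auto

lemma funs_Disj: "funs (Disj As) = (\<Union>A\<in>set As. funs A)"
  by (induction As rule: Disj.induct) auto

text \<open>Equal lengths are essential, since the last list entry may itself be a
  conjunction.\<close>

lemma Conj_inject: "length As = length Bs \<Longrightarrow> Conj As = Conj Bs \<Longrightarrow> As = Bs"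
proof (induction As arbitrary: Bs rule: Conj.induct)
  case (2 A)
  then show ?case by (cases Bs) auto
next
  case (3 A B As)
  then obtain A' B' Bs' where "Bs = A' # B' # Bs'"
    by (metis length_Suc_conv)
  then show ?case using 3 "3.IH"[of "B' # Bs'"] by simp
qed simp

lemma Disj_inject: "length As = length Bs \<Longrightarrow> Disj As = Disj Bs \<Longrightarrow> As = Bs"
proof (induction As arbitrary: Bs rule: Disj.induct)
  case (2 A)
  then show ?case by (cases Bs) auto
next
  case (3 A B As)
  then obtain A' B' Bs' where "Bs = A' # B' # Bs'"
    by (metis length_Suc_conv)
  then show ?case using 3 "3.IH"[of "B' # Bs'"] by simp
qed simp

lemma Conj_Cons: "As \<noteq> [] \<Longrightarrow> Conj (A # As) = And A (Conj As)"
  by (cases As) auto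

lemma Disj_Cons: "As \<noteq> [] \<Longrightarrow> Disj (A # As) = Or A (Disj As)"
  by (cases As) auto

text \<open>Turns a Skolemization step on the conjunction into a step on one formula of the sequent;
  \<open>n\<close> is unchanged, as no quantifier is passed on the way.\<close>

lemma skolem_first_Conj:
  "has_strong p (Conj As) \<Longrightarrow> \<exists>xs A ys. As = xs @ A # ys \<and> has_strong p A \<and>
    skolem_first p n f (Conj As) = Conj (xs @ skolem_first p n f A # ys)"
proof (induction As rule: Conj.induct)
  case (2 A)
  then show ?case by (intro exI[of _ "[]"] exI[of _ A]) auto
next
  case (3 A B As)
  show ?case
  proof (cases "has_strong p A")
    case True
    then show ?thesis by (intro exI[of _ "[]"] exI[of _ A] exI[of _ "B # As"]) auto
  next
    case False
    then obtain xs C ys where C: "B # As = xs @ C # ys" "has_strong p C"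
        "skolem_first p n f (Conj (B # As)) = Conj (xs @ skolem_first p n f C # ys)"
      using 3 by auto
    show ?thesis
      using C False by (intro exI[of _ "A # xs"] exI[of _ C] exI[of _ ys]) (auto simp: Conj_Cons)
  qed
qed simp

lemma skolem_first_Disj:
  "has_strong p (Disj As) \<Longrightarrow> \<exists>xs A ys. As = xs @ A # ys \<and> has_strong p A \<and>
    skolem_first p n f (Disj As) = Disj (xs @ skolem_first p n f A # ys)"
proof (induction As rule: Disj.induct)
  case (2 A)
  then show ?case by (intro exI[of _ "[]"] exI[of _ A]) auto
next
  case (3 A B As)
  show ?case
  proof (cases "has_strong p A")
    case True
    then show ?thesis by (intro exI[of _ "[]"] exI[of _ A] exI[of _ "B # As"]) auto
  next
    case False
    then obtain xs C ys where C: "B # As = xs @ C # ys" "has_strong p C"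
        "skolem_first p n f (Disj (B # As)) = Disj (xs @ skolem_first p n f C # ys)"
      using 3 by auto
    show ?thesis
      using C False by (intro exI[of _ "A # xs"] exI[of _ C] exI[of _ ys]) (auto simp: Disj_Cons)
  qed
qed simp

lemma rel_mset_refl_on: "\<forall>A\<in>#M. R A A \<Longrightarrow> rel_mset R M M"
  by (simp add: multiset.rel_refl_strong)

text \<open>The rule induction peels off the symbol introduced first, so its hypothesis has already
  eliminated all later ones. List lengths are preserved, which keeps every intermediate formula
  decomposable as a sequent.\<close>

lemma suitably_derivable_skolem_iter:
  assumes "skolem_iter U F G" and "F = Imp (Conj As) (Disj Bs)" and "G = Imp (Conj Cs) (Disj Ds)"
    and "length Cs = length As" and "length Ds = length Bs"
    and "closed_fm F" and "funs F \<subseteq> U" and "suitably_derivable (mset Cs \<turnstile> mset Ds)"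
  shows "suitably_derivable (mset As \<turnstile> mset Bs)"
  using assms
proof (induction arbitrary: As Bs rule: skolem_iter.induct)
  case (1 F U)
  then have "As = Cs" "Bs = Ds" using Conj_inject Disj_inject by fastforce+
  then show ?case using 1 by simp
next
  case (2 F f U G)
  have closed: "closed_fm A" "f \<notin> funs A" if "A \<in> set As \<union> set Bs" for A
    using that "2.hyps"(2) "2.prems"(1,5,6)
    by (auto simp: closed_fm_def lc_Conj lc_Disj fv_Conj fv_Disj funs_Conj funs_Disj)
  have same: "rel_mset (skolem_step f Q p) M M" if "set_mset M \<subseteq> set As \<union> set Bs" for Q p M
    using that closed by (intro rel_mset_refl_on) (auto simp: skolem_step_def)
  have closed': "closed_fm (skolem_first True 0 f F)" "funs (skolem_first True 0 f F) \<subseteq> insert f U"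
    using \<open>closed_fm F\<close> \<open>funs F \<subseteq> U\<close> lc_skolem_first[of 0 F True f] fv_skolem_first[of True 0 f F]
      funs_skolem_first[of True 0 f F]
    by (auto simp: closed_fm_def)
  have step: "skolem_step f (first_strong p A) p (skolem_first p 0 f A) A"
      "fv (first_strong p A) = {}" if "A \<in> set As \<union> set Bs" "has_strong p A" for p A
    using that closed[OF that(1)] fv_first_strong[of p A] by (auto simp: skolem_step_def closed_fm_def)
  show ?case
  proof (cases "has_strong False (Conj As)")
    case True
    then obtain xs A ys where A: "As = xs @ A # ys" "has_strong False A"
        "skolem_first False 0 f (Conj As) = Conj (xs @ skolem_first False 0 f A # ys)"
      using skolem_first_Conj[OF True, of 0 f] by blast
    have F': "skolem_first True 0 f F = Imp (Conj (xs @ skolem_first False 0 f A # ys)) (Disj Bs)"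
      using \<open>F = _\<close> A(3) True by simp
    have "suitably_derivable (mset (xs @ skolem_first False 0 f A # ys) \<turnstile> mset Bs)"
      using "2.prems"(3,4) A(1)
      by (intro "2.IH"[OF F' "2.prems"(2) _ _ closed' "2.prems"(7)]) simp_all
    moreover have "rel_mset (skolem_step f (first_strong False A) False)
        (mset (xs @ skolem_first False 0 f A # ys)) (mset As)"
      using rel_mset_Plus[where R = "skolem_step f (first_strong False A) False", OF step(1) same[of "mset xs + mset ys"]] A by auto
    moreover have "fv (first_strong False A) = {}" using step(2) A(1,2) by simp
    ultimately show ?thesis
      using suitably_derivable_skolem_step[where Q = "first_strong False A" and f = f]
        same[of "mset Bs" "first_strong False A" True]
      by simp
  next
    case False
    then have "has_strong True (Disj Bs)" using "2.hyps"(1) "2.prems"(1) by simp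
    from skolem_first_Disj[OF this, of 0 f] obtain xs A ys where A: "Bs = xs @ A # ys" "has_strong True A"
        "skolem_first True 0 f (Disj Bs) = Disj (xs @ skolem_first True 0 f A # ys)"
      by blast
    have F': "skolem_first True 0 f F = Imp (Conj As) (Disj (xs @ skolem_first True 0 f A # ys))"
      using \<open>F = _\<close> A(3) False by simp
    have "suitably_derivable (mset As \<turnstile> mset (xs @ skolem_first True 0 f A # ys))"
      using "2.prems"(3,4) A(1)
      by (intro "2.IH"[OF F' "2.prems"(2) _ _ closed' "2.prems"(7)]) simp_all
    moreover have "rel_mset (skolem_step f (first_strong True A) True)
        (mset (xs @ skolem_first True 0 f A # ys)) (mset Bs)"
      using rel_mset_Plus[where R = "skolem_step f (first_strong True A) True", OF step(1) same[of "mset xs + mset ys"]] A by auto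
    moreover have "fv (first_strong True A) = {}" using step(2) A(1,2) by simp
    ultimately show ?thesis
      using suitably_derivable_skolem_step[where Q = "first_strong True A" and f = f]
        same[of "mset As" "first_strong True A" False]
      by simp
  qed
qed

theorem mainTheorem7:
  fixes \<Gamma> \<Delta> \<Pi> \<Lambda> :: "('f, 'p) fm multiset"
  assumes "seq_skolemization (\<Gamma> \<turnstile> \<Delta>) (\<Pi> \<turnstile> \<Lambda>)"
    and "\<exists>\<pi>. LJpp_proof \<pi> \<and> end_sequent \<pi> = (\<Pi> \<turnstile> \<Lambda>) \<and> cut_free \<pi> \<and> atomic_axioms \<pi>"
  shows "\<exists>\<pi>. LJpp_proof \<pi> \<and> end_sequent \<pi> = (\<Gamma> \<turnstile> \<Delta>) \<and> cut_free \<pi>"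
proof -
  obtain As Bs Cs Ds where S: "\<Gamma> = mset As" "\<Delta> = mset Bs" "\<Pi> = mset Cs" "\<Lambda> = mset Ds"
      "length Cs = length As" "length Ds = length Bs"
      "skolemization (Imp (Conj As) (Disj Bs)) (Imp (Conj Cs) (Disj Ds))"
    using assms(1) by (auto simp: seq_skolemization_def)
  have closed: "closed_fm (Imp (Conj As) (Disj Bs))"
    and iter: "skolem_iter (funs (Imp (Conj As) (Disj Bs)))
      (Imp (Conj As) (Disj Bs)) (Imp (Conj Cs) (Disj Ds))"
    using S(7) by (auto simp: skolemization_def)
  have "suitably_derivable (mset Cs \<turnstile> mset Ds)"
    using assms(2) S suitably_derivable_of_proof by metis
  then have "suitably_derivable (\<Gamma> \<turnstile> \<Delta>)"
    using suitably_derivable_skolem_iter[OF iter refl refl S(5,6) closed] S(1,2) by simp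
  \<comment> \<open>Closedness supplies the missing condition that no characteristic variable occurs
    in the end-sequent.\<close>
  moreover have "fv_seq (\<Gamma> \<turnstile> \<Delta>) = {}"
    using closed S(1,2) by (auto simp: closed_fm_def fv_Conj fv_Disj)
  ultimately show ?thesis by (rule proof_of_suitably_derivable)
qed

end
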